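(* Let $G$ be a group of order $8$, let $\mathbb{F}$ be an algebraically closed field with $\operatorname{char}(\mathbb{F})\neq 2$, let $n$ be a positive integer, and let $(\rho,\mathbb{V})$ be an $n$ degree representation of $G$ over $\mathbb{F}$, $\rho=\bigoplus_{i=1}^{r}k_i\rho_i$. Let $A_G=\{(i,j)\mid \rho_i \text{ and } \rho_j \text{ are dual to each other}\}$, and for $(i,j)\in A_G$ let $\mathbb{W}_{(i,j)}$ be the subspace of $\mathbb{M}_n(\mathbb{F})$ consisting of all $X\in\mathbb{M}_n(\mathbb{F})$ whose $(i,j)$-th block $X^{ij}$, of order $d_ik_i\times d_jk_j$, satisfies $$X^{ij}=C_{k_i\rho_i(g)}^{t}\,X^{ij}\,C_{k_j\rho_j(g)}\quad\text{for all } g\in G,$$ and all of whose other blocks are zero. Then the space $\Xi_G$ of bilinear forms on $\mathbb{V}$ invariant under $\rho$ is isomorphic to the direct sum of the subspaces $\mathbb{W}_{(i,j)}$, $(i,j)\in A_G$; that is, $$\Xi_G'=\bigoplus_{(i,j)\in A_G}\mathbb{W}_{(i,j)}.$$ Moreover $\dim_{\mathbb{F}}\mathbb{W}_{(i,j)}=k_ik_j$ for every $(i,j)\in A_G$.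
   Context: An $n$ degree representation is a homomorphism $\rho:G\to GL(\mathbb{V})$ with $\mathbb{V}$ an $n$-dimensional vector space over $\mathbb{F}$. $\rho_1,\dots,\rho_r$ is a complete list of pairwise non-isomorphic irreducible representations of $G$ over $\mathbb{F}$, each with a fixed matrix realization, of degrees $d_1,\dots,d_r$ ordered so that $d_j\ge d_i$ when $j>i$. $k_i\rho_i$ denotes the direct sum of $k_i\geq 0$ copies of $\rho_i$, so $\sum_i d_ik_i=n$. The space of invariant bilinear forms is $\Xi_G=\{\mathbb{B}:\mathbb{V}\times\mathbb{V}\to\mathbb{F}\text{ bilinear}\mid \mathbb{B}(\rho(g)x,\rho(g)y)=\mathbb{B}(x,y)\ \forall g\in G,\ x,y\in\mathbb{V}\}$. Fix an ordered basis of $\mathbb{V}$ adapted to the decomposition $\rho=\bigoplus_i k_i\rho_i$, so that the matrix $C_{\rho(g)}$ of $\rho(g)$ is block diagonal with diagonal blocks $C_{k_1\rho_1(g)},\dots,C_{k_r\rho_r(g)}$, where $C_{k_i\rho_i(g)}$ is itself block diagonal with $k_i$ copies of the matrix of $\rho_i(g)$. Matrices $X\in\mathbb{M}_n(\mathbb{F})$ (the $n\times n$ matrices over $\mathbb{F}$) are partitioned correspondingly into blocks $X^{ij}$ of order $d_ik_i\times d_jk_j$, $1\le i,j\le r$. Then $\Xi_G'=\{X\in\mathbb{M}_n(\mathbb{F})\mid C_{\rho(g)}^{t}XC_{\rho(g)}=X\ \forall g\in G\}$, which is the matrix form of $\Xi_G$ with respect to this basis. $\rho_i$ and $\rho_j$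 are dual to each other if $\rho_j$ is isomorphic to the dual (contragredient) representation of $\rho_i$; $A_G$ consists of ordered pairs. *)

theory Defs
  imports "Jordan_Normal_Form.VS_Connect"
begin

text \<open>
  The abstract space \<open>V\<close> is a type \<open>'v\<close> with a scalar multiplication \<open>scale\<close> that forms a
  \<^locale>\<open>vector_space\<close>; spaces of matrices and of forms are module records over \<open>class_ring\<close>.
  All indices start at 0: the irreducible representations are \<open>R 0, \<dots>, R (r - 1)\<close>, and bases,
  rows and columns are indexed by \<open>0, \<dots>, n - 1\<close>.
\<close>

subsection \<open>Representations on an abstract space\<close>

definition GL_space :: "('f::field \<Rightarrow> 'v::ab_group_add \<Rightarrow> 'v) \<Rightarrow> ('v \<Rightarrow> 'v) monoid" where
  "GL_space scale =
    \<lparr>carrier = {f. Vector_Spaces.linear scale scale f \<and> bij f}, mult = (\<circ>), one = id\<rparr>"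

definition representation_of_degree ::
    "('g, 'c) monoid_scheme \<Rightarrow> ('f::field \<Rightarrow> 'v::ab_group_add \<Rightarrow> 'v) \<Rightarrow> nat \<Rightarrow> ('g \<Rightarrow> 'v \<Rightarrow> 'v) \<Rightarrow> bool"
  where
  "representation_of_degree G scale n \<rho> \<longleftrightarrow>
     vector_space scale \<and> vector_space.dim scale (UNIV :: 'v set) = n \<and> \<rho> \<in> hom G (GL_space scale)"

definition ordered_basis ::
    "('f::field \<Rightarrow> 'v::ab_group_add \<Rightarrow> 'v) \<Rightarrow> nat \<Rightarrow> (nat \<Rightarrow> 'v) \<Rightarrow> bool" where
  "ordered_basis scale n b \<longleftrightarrow>
     inj_on b {..<n} \<and> \<not> module.dependent scale (b ` {..<n}) \<and> module.span scale (b ` {..<n}) = UNIV"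

text \<open>Column \<open>q\<close> consists of the coordinates of \<open>f (b q)\<close>.\<close>

definition matrix_of_map ::
    "('f::field \<Rightarrow> 'v::ab_group_add \<Rightarrow> 'v) \<Rightarrow> nat \<Rightarrow> (nat \<Rightarrow> 'v) \<Rightarrow> ('v \<Rightarrow> 'v) \<Rightarrow> 'f mat" where
  "matrix_of_map scale n b f =
     mat n n (\<lambda>(p, q). module.representation scale (b ` {..<n}) (f (b q)) (b p))"

subsection \<open>Invariant bilinear forms\<close>

definition bilinear_form ::
    "('f::field \<Rightarrow> 'v::ab_group_add \<Rightarrow> 'v) \<Rightarrow> ('v \<Rightarrow> 'v \<Rightarrow> 'f) \<Rightarrow> bool" where
  "bilinear_form scale B \<longleftrightarrow>
     (\<forall>y. Vector_Spaces.linear scale (*) (\<lambda>x. B x y)) \<and>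
     (\<forall>x. Vector_Spaces.linear scale (*) (\<lambda>y. B x y))"

definition invariant_forms ::
    "('g, 'c) monoid_scheme \<Rightarrow> ('f::field \<Rightarrow> 'v::ab_group_add \<Rightarrow> 'v) \<Rightarrow> ('g \<Rightarrow> 'v \<Rightarrow> 'v)
      \<Rightarrow> ('v \<Rightarrow> 'v \<Rightarrow> 'f) set" where
  "invariant_forms G scale \<rho> =
     {B. bilinear_form scale B \<and> (\<forall>g\<in>carrier G. \<forall>x y. B (\<rho> g x) (\<rho> g y) = B x y)}"

definition form_space :: "('v \<Rightarrow> 'v \<Rightarrow> 'f::field) set \<Rightarrow> ('f, 'v \<Rightarrow> 'v \<Rightarrow> 'f) module" where
  "form_space S =
    \<lparr>carrier = S, mult = undefined, one = undefined,
     zero = (\<lambda>x y. 0), add = (\<lambda>A B x y. A x y + B x y), smult = (\<lambda>c B x y. c * B x y)\<rparr>"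

definition matrix_of_form :: "nat \<Rightarrow> (nat \<Rightarrow> 'v) \<Rightarrow> ('v \<Rightarrow> 'v \<Rightarrow> 'f) \<Rightarrow> 'f mat" where
  "matrix_of_form n b B = mat n n (\<lambda>(p, q). B (b p) (b q))"

text \<open>The set \<open>\<Xi>'\<close> for a family \<open>C g\<close> of \<open>n \<times> n\<close> matrices.\<close>

definition invariant_matrices ::
    "('g, 'c) monoid_scheme \<Rightarrow> nat \<Rightarrow> ('g \<Rightarrow> 'f::field mat) \<Rightarrow> 'f mat set" where
  "invariant_matrices G n C =
     {X \<in> carrier_mat n n. \<forall>g\<in>carrier G. transpose_mat (C g) * X * C g = X}"

subsection \<open>Matrix representations\<close>

definition matrix_rep ::
    "('g, 'c) monoid_scheme \<Rightarrow> nat \<Rightarrow> ('g \<Rightarrow> 'f::field mat) \<Rightarrow> bool" where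
  "matrix_rep G d R \<longleftrightarrow> R \<in> hom G (units_of (ring_mat TYPE('f) d ()))"

definition irreducible_rep ::
    "('g, 'c) monoid_scheme \<Rightarrow> nat \<Rightarrow> ('g \<Rightarrow> 'f::field mat) \<Rightarrow> bool" where
  "irreducible_rep G d R \<longleftrightarrow>
     matrix_rep G d R \<and> d > 0 \<and>
     (\<forall>U. VectorSpace.subspace class_ring U (module_vec TYPE('f) d) \<longrightarrow>
          (\<forall>g\<in>carrier G. \<forall>u\<in>U. R g *\<^sub>v u \<in> U) \<longrightarrow>
          U = {0\<^sub>v d} \<or> U = carrier_vec d)"

definition isomorphic_reps ::
    "('g, 'c) monoid_scheme \<Rightarrow> nat \<Rightarrow> ('g \<Rightarrow> 'f::field mat) \<Rightarrow> nat \<Rightarrow> ('g \<Rightarrow> 'f mat) \<Rightarrow> bool" where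
  "isomorphic_reps G d R e S \<longleftrightarrow>
     (\<exists>P \<in> carrier_mat e d. \<exists>Q \<in> carrier_mat d e.
        inverts_mat P Q \<and> inverts_mat Q P \<and> (\<forall>g\<in>carrier G. P * R g = S g * P))"

text \<open>The contragredient representation, written in the dual basis.\<close>

definition dual_rep ::
    "('g, 'c) monoid_scheme \<Rightarrow> ('g \<Rightarrow> 'f::field mat) \<Rightarrow> 'g \<Rightarrow> 'f mat" where
  "dual_rep G R g = transpose_mat (R (inv\<^bsub>G\<^esub> g))"

text \<open>
  Every irreducible representation of a finite group is finite-dimensional, so completeness can
  be expressed through matrix representations of arbitrary degree \<open>e\<close>.
\<close>

definition complete_irreps ::
    "('g, 'c) monoid_scheme \<Rightarrow> nat \<Rightarrow> (nat \<Rightarrow> nat) \<Rightarrow> (nat \<Rightarrow> 'g \<Rightarrow> 'f::field mat) \<Rightarrow> bool" where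
  "complete_irreps G r d R \<longleftrightarrow>
     (\<forall>i<r. irreducible_rep G (d i) (R i)) \<and>
     (\<forall>i<r. \<forall>j<r. i \<noteq> j \<longrightarrow> \<not> isomorphic_reps G (d i) (R i) (d j) (R j)) \<and>
     (\<forall>e S. irreducible_rep G e (S :: 'g \<Rightarrow> 'f mat) \<longrightarrow>
        (\<exists>i<r. isomorphic_reps G (d i) (R i) e S)) \<and>
     (\<forall>i<r. \<forall>j<r. i < j \<longrightarrow> d i \<le> d j)"

definition multiple_rep :: "nat \<Rightarrow> ('g \<Rightarrow> 'f::field mat) \<Rightarrow> 'g \<Rightarrow> 'f mat" where
  "multiple_rep m R g = diag_block_mat (replicate m (R g))"

definition direct_sum_rep ::
    "nat \<Rightarrow> (nat \<Rightarrow> nat) \<Rightarrow> (nat \<Rightarrow> 'g \<Rightarrow> 'f::field mat) \<Rightarrow> 'g \<Rightarrow> 'f mat" where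
  "direct_sum_rep r k R g = diag_block_mat (map (\<lambda>i. multiple_rep (k i) (R i) g) [0..<r])"

text \<open>
  The basis \<open>b\<close> realises \<open>\<rho>\<close> as the direct sum of \<open>k i\<close> copies of \<open>R i\<close>. Comparing the sizes of
  the two matrices gives \<open>(\<Sum>i<r. d i * k i) = n\<close>.
\<close>

definition adapted_basis ::
    "('g, 'c) monoid_scheme \<Rightarrow> ('f::field \<Rightarrow> 'v::ab_group_add \<Rightarrow> 'v) \<Rightarrow> nat \<Rightarrow> ('g \<Rightarrow> 'v \<Rightarrow> 'v)
      \<Rightarrow> nat \<Rightarrow> (nat \<Rightarrow> nat) \<Rightarrow> (nat \<Rightarrow> 'g \<Rightarrow> 'f mat) \<Rightarrow> (nat \<Rightarrow> 'v) \<Rightarrow> bool" where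
  "adapted_basis G scale n \<rho> r k R b \<longleftrightarrow>
     ordered_basis scale n b \<and>
     (\<forall>g\<in>carrier G. matrix_of_map scale n b (\<rho> g) = direct_sum_rep r k R g)"

definition dual_pairs ::
    "('g, 'c) monoid_scheme \<Rightarrow> nat \<Rightarrow> (nat \<Rightarrow> nat) \<Rightarrow> (nat \<Rightarrow> 'g \<Rightarrow> 'f::field mat) \<Rightarrow> (nat \<times> nat) set"
  where
  "dual_pairs G r d R =
     {(i, j). i < r \<and> j < r \<and> isomorphic_reps G (d j) (R j) (d i) (dual_rep G (R i))}"

subsection \<open>Blocks\<close>

definition mat_block ::
    "(nat \<Rightarrow> nat) \<Rightarrow> (nat \<Rightarrow> nat) \<Rightarrow> 'f mat \<Rightarrow> nat \<Rightarrow> nat \<Rightarrow> 'f mat" where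
  "mat_block d k X i j =
     mat (d i * k i) (d j * k j)
       (\<lambda>(p, q). X $$ ((\<Sum>l<i. d l * k l) + p, (\<Sum>l<j. d l * k l) + q))"

definition block_space ::
    "('g, 'c) monoid_scheme \<Rightarrow> nat \<Rightarrow> nat \<Rightarrow> (nat \<Rightarrow> nat) \<Rightarrow> (nat \<Rightarrow> nat) \<Rightarrow> (nat \<Rightarrow> 'g \<Rightarrow> 'f::field mat)
      \<Rightarrow> nat \<times> nat \<Rightarrow> 'f mat set" where
  "block_space G n r d k R = (\<lambda>(i, j).
     {X \<in> carrier_mat n n.
        (\<forall>g\<in>carrier G.
           mat_block d k X i j =
             transpose_mat (multiple_rep (k i) (R i) g) * mat_block d k X i j
               * multiple_rep (k j) (R j) g) \<and>
        (\<forall>i'<r. \<forall>j'<r. (i', j') \<noteq> (i, j) \<longrightarrow>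
           mat_block d k X i' j' = 0\<^sub>m (d i' * k i') (d j' * k j'))})"

definition internal_direct_sum ::
    "('f, 'c) ring_scheme \<Rightarrow> ('f, 'm, 'e) module_scheme \<Rightarrow> 'm set \<Rightarrow> 'i set \<Rightarrow> ('i \<Rightarrow> 'm set) \<Rightarrow> bool"
  where
  "internal_direct_sum K M U I W \<longleftrightarrow>
     finite I \<and> (\<forall>i\<in>I. VectorSpace.subspace K (W i) M) \<and>
     U = {finsum M x I | x. x \<in> Pi I W} \<and>
     (\<forall>x \<in> Pi I W. finsum M x I = \<zero>\<^bsub>M\<^esub> \<longrightarrow> (\<forall>i\<in>I. x i = \<zero>\<^bsub>M\<^esub>))"

end

theory Submission
  imports Defs "Jordan_Normal_Form.Char_Poly"
begin

text \<open>
  Cut an invariant matrix \<open>X\<close> along the decomposition of \<open>\<rho>\<close> into single irreducible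
  summands. Since the matrices of \<open>\<rho>\<close> are block diagonal, \<open>X\<close> is invariant exactly when each
  small block \<open>Y\<close> satisfies \<open>R\<^sub>i(g)\<^sup>t Y R\<^sub>j(g) = Y\<close>, that is, when \<open>Y\<close> intertwines \<open>R\<^sub>j\<close> with
  the dual of \<open>R\<^sub>i\<close>. The transpose of \<open>Y\<close> has the same property with \<open>i\<close> and \<open>j\<close> exchanged, so
  Schur's lemma applied to both shows that \<open>Y\<close> is zero or invertible; hence \<open>Y = 0\<close> unless
  \<open>(i, j)\<close> is a dual pair, and for a dual pair the solutions are the multiples of one matrix \<open>P\<close>,
  which leaves one free scalar for each of the \<open>k i * k j\<close> small blocks.
\<close>

subsection \<open>Block partitions\<close>

text \<open>The same sum serves as the start of block \<open>i\<close> and as the total size of the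
  first \<open>i\<close> blocks, so the order of a matrix cut into \<open>m\<close> blocks is
  written \<open>block_offset s m\<close>.\<close>

abbreviation block_offset :: "(nat \<Rightarrow> nat) \<Rightarrow> nat \<Rightarrow> nat" where
  "block_offset s i \<equiv> (\<Sum>l<i. s l)"

lemma block_offset_mono: "i \<le> j \<Longrightarrow> block_offset s i \<le> block_offset s j"
  by (intro sum_mono2) auto

lemma block_offset_less:
  assumes "i < m" "p < s i"
  shows "block_offset s i + p < block_offset s m"
proof -
  have "block_offset s i + p < block_offset s (Suc i)" using assms by simp
  also have "\<dots> \<le> block_offset s m" using assms by (intro block_offset_mono) simp
  finally show ?thesis .
qed

text \<open>Blocks occupy disjoint intervals: if \<open>i < j\<close>, block \<open>i\<close> ends
  no later than the start of block \<open>j\<close>, so no index lies in both. Together with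
  \<open>block_offset_cases\<close> this gives every index a unique address consisting of a block
  number and a position.\<close>

lemma block_offset_inject:
  assumes "block_offset s i + p = block_offset s j + q" "p < s i" "q < s j"
  shows "i = j \<and> p = q"
proof -
  have "\<not> i < j" using block_offset_less[of i j p s] assms by auto
  moreover have "\<not> j < i" using block_offset_less[of j i q s] assms by auto
  ultimately have "i = j" by simp
  with assms show ?thesis by simp
qed

lemma block_offset_cases:
  assumes "u < block_offset s m"
  obtains i p where "i < m" "p < s i" "u = block_offset s i + p"
  using assms
proof (induction m arbitrary: thesis)
  case (Suc m)
  show ?case
  proof (cases "u < block_offset s m")
    case True
    then show ?thesis using Suc.IH Suc.prems(1) less_SucI by metis
  next
    case False
    then show ?thesis
      using Suc.prems(2) by (intro Suc.prems(1)[of m "u - block_offset s m"]) auto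
  qed
qed simp

lemma sum_lessThan_add:
  fixes f :: "nat \<Rightarrow> 'a::comm_monoid_add"
  shows "sum f {..<a + b} = sum f {..<a} + (\<Sum>p<b. f (a + p))"
  by (induction b) (auto simp: add.assoc)

lemma sum_lessThan_block_offset:
  fixes f :: "nat \<Rightarrow> 'a::comm_monoid_add"
  shows "sum f {..<block_offset s m} = (\<Sum>l<m. \<Sum>p<s l. f (block_offset s l + p))"
  by (induction m) (auto simp: sum_lessThan_add)

text \<open>Rows and columns have independent size functions. The choice \<open>deg\<close> yields
  the partition into blocks for \<open>k i\<close> copies of \<open>R i\<close>; constant functions
  yield the finer partition of such a block into pieces belonging to single irreducible
  summands.\<close>

definition block_of :: "(nat \<Rightarrow> nat) \<Rightarrow> (nat \<Rightarrow> nat) \<Rightarrow> 'a mat \<Rightarrow> nat \<Rightarrow> nat \<Rightarrow> 'a mat" where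
  "block_of s t X i j =
     mat (s i) (t j) (\<lambda>(p, q). X $$ (block_offset s i + p, block_offset t j + q))"

lemma block_of_carrier [simp]: "block_of s t X i j \<in> carrier_mat (s i) (t j)"
  by (simp add: block_of_def)

lemma mat_block_eq_block_of: "mat_block d k = block_of (\<lambda>l. d l * k l) (\<lambda>l. d l * k l)"
  by (intro ext) (simp add: mat_block_def block_of_def)

lemma block_of_eqI:
  assumes X: "X \<in> carrier_mat (block_offset s m) (block_offset t l)"
    and Y: "Y \<in> carrier_mat (block_offset s m) (block_offset t l)"
    and eq: "\<And>i j. i < m \<Longrightarrow> j < l \<Longrightarrow> block_of s t X i j = block_of s t Y i j"
  shows "X = Y"
proof (rule eq_matI)
  fix u v assume "u < dim_row Y" "v < dim_col Y"
  with Y have "u < block_offset s m" "v < block_offset t l" by auto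
  then obtain i p j q where i: "i < m" "p < s i" "u = block_offset s i + p"
    and j: "j < l" "q < t j" "v = block_offset t j + q"
    by (metis block_offset_cases)
  have "block_of s t X i j $$ (p, q) = block_of s t Y i j $$ (p, q)" using eq i j by simp
  with i j show "X $$ (u, v) = Y $$ (u, v)" by (simp add: block_of_def)
qed (use X Y in auto)

lemma block_of_add:
  assumes "X \<in> carrier_mat (block_offset s m) (block_offset t l)"
    and "Y \<in> carrier_mat (block_offset s m) (block_offset t l)" and "i < m" "j < l"
  shows "block_of s t (X + Y) i j = block_of s t X i j + block_of s t Y i j"
  using assms by (intro eq_matI) (auto simp: block_of_def block_offset_less)

lemma block_of_smult:
  assumes "X \<in> carrier_mat (block_offset s m) (block_offset t l)" and "i < m" "j < l"
  shows "block_of s t (c \<cdot>\<^sub>m X) i j = c \<cdot>\<^sub>m block_of s t X i j"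
  using assms by (intro eq_matI) (auto simp: block_of_def block_offset_less)

lemma block_of_zero:
  assumes "i < m" "j < l"
  shows "block_of s t (0\<^sub>m (block_offset s m) (block_offset t l)) i j = 0\<^sub>m (s i) (t j)"
  using assms by (intro eq_matI) (auto simp: block_of_def block_offset_less)

lemma block_of_transpose:
  assumes "X \<in> carrier_mat (block_offset s m) (block_offset t l)" and "i < m" "j < l"
  shows "block_of t s (transpose_mat X) j i = transpose_mat (block_of s t X i j)"
  using assms by (intro eq_matI) (auto simp: block_of_def block_offset_less)

text \<open>Since block addresses are unique, the blocks of a matrix can be prescribed independently
  of each other.\<close>

lemma ex_mat_of_blocks:
  assumes F: "\<And>i j. i < m \<Longrightarrow> j < l \<Longrightarrow> F i j \<in> carrier_mat (s i) (t j)"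
  shows "\<exists>X \<in> carrier_mat (block_offset s m) (block_offset t l).
           \<forall>i<m. \<forall>j<l. block_of s t X i j = F i j"
proof -
  \<comment> \<open>The function decodes an index into its address; it is needed once for rows and
    once for columns. Outside all blocks its value is arbitrary.\<close>
  have "\<exists>f. \<forall>i p. p < s i \<longrightarrow> f (block_offset s i + p) = (i, p)" for s :: "nat \<Rightarrow> nat"
    by (rule exI[of _ "\<lambda>u. THE ip. snd ip < s (fst ip) \<and> u = block_offset s (fst ip) + snd ip"])
       (intro allI impI the_equality, auto dest: block_offset_inject)
  then obtain f g where
    f: "\<And>i p. p < s i \<Longrightarrow> f (block_offset s i + p) = (i, p)" and
    g: "\<And>j q. q < t j \<Longrightarrow> g (block_offset t j + q) = (j, q)"
    by metis
  define X where "X = mat (block_offset s m) (block_offset t l)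
    (\<lambda>(u, v). F (fst (f u)) (fst (g v)) $$ (snd (f u), snd (g v)))"
  have "block_of s t X i j = F i j" if "i < m" "j < l" for i j
    using that F[OF that]
    by (intro eq_matI) (auto simp: block_of_def X_def f g block_offset_less)
  then show ?thesis by (intro bexI[of _ X]) (auto simp: X_def)
qed

subsection \<open>Congruence by block diagonal matrices\<close>

locale square_blocks =
  fixes s :: "nat \<Rightarrow> nat" and As :: "'a::field mat list"
  assumes nth_carrier: "\<And>i. i < length As \<Longrightarrow> As ! i \<in> carrier_mat (s i) (s i)"

lemma diag_block_mat_carrier:
  assumes "square_blocks s As"
  shows "diag_block_mat As \<in> carrier_mat (block_offset s (length As)) (block_offset s (length As))"
proof -
  interpret square_blocks s As by fact
  have dims: "dim_row (As ! i) = s i" "dim_col (As ! i) = s i" if "i < length As" for i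
    using nth_carrier[OF that] by simp_all
  have "sum_list (map dim_row As) = block_offset s (length As)"
    "sum_list (map dim_col As) = block_offset s (length As)"
    unfolding sum_list_sum_nth length_map atLeast0LessThan
    by (rule sum.cong; simp add: dims)+
  then show ?thesis by (intro carrier_matI) (simp_all only: dim_diag_block_mat)
qed

text \<open>Induction from the right end of the list: appending a block leaves the offsets of the
  earlier blocks unchanged, whereas removing the first block would shift them all.\<close>

lemma index_diag_block_mat:
  assumes "square_blocks s As" and "i < length As" "j < length As" "p < s i" "q < s j"
  shows "diag_block_mat As $$ (block_offset s i + p, block_offset s j + q) =
           (if i = j then (As ! i) $$ (p, q) else 0)"
  using assms
proof (induction As rule: rev_induct)
  case (snoc B As)
  interpret square_blocks s "As @ [B]" by fact
  let ?m = "length As"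
  have sq: "square_blocks s As"
  proof
    fix i assume "i < length As"
    then show "As ! i \<in> carrier_mat (s i) (s i)" using nth_carrier[of i] by (simp add: nth_append)
  qed
  have B: "B \<in> carrier_mat (s ?m) (s ?m)" using nth_carrier[of ?m] by simp
  have D: "diag_block_mat As \<in> carrier_mat (block_offset s ?m) (block_offset s ?m)"
    by (rule diag_block_mat_carrier[OF sq])
  \<comment> \<open>An address either lies in the leading part, where the induction hypothesis
    applies, or belongs to the appended block. This decides which of the four quadrants of the
    matrix is meant.\<close>
  have lt: "l < ?m \<and> block_offset s l + x < block_offset s ?m \<or> l = ?m"
    if "l < length (As @ [B])" "x < s l" for l x
    using that block_offset_less[of l ?m x s] by auto
  have le: "block_offset s l + x < block_offset s ?m + s ?m"
    if "l < length (As @ [B])" "x < s l" for l x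
    using that block_offset_less[of l "Suc ?m" x s] by simp
  let ?D = "diag_block_mat As"
  let ?u = "block_offset s i + p" and ?v = "block_offset s j + q"
  have "diag_block_mat (As @ [B]) $$ (?u, ?v) =
    (if ?u < block_offset s ?m
     then if ?v < block_offset s ?m then ?D $$ (?u, ?v) else 0
     else if ?v < block_offset s ?m then 0
     else B $$ (?u - block_offset s ?m, ?v - block_offset s ?m))"
    using le[OF snoc.prems(2,4)] le[OF snoc.prems(3,5)] B D
    by (simp add: diag_block_mat_last Let_def)
  also have "\<dots> = (if i = j then ((As @ [B]) ! i) $$ (p, q) else 0)"
  proof (cases "i < ?m")
    case True
    then show ?thesis
      using lt[OF snoc.prems(2,4)] lt[OF snoc.prems(3,5)] snoc.IH[OF sq True _ snoc.prems(4,5)]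
      by (auto simp: nth_append)
  next
    case False
    then have "i = ?m" using snoc.prems by simp
    then show ?thesis
      using lt[OF snoc.prems(3,5)] by auto
  qed
  finally show ?case .
qed simp

text \<open>The inner sum of the matrix product is split along the partition \<open>t\<close>. In
  block column \<open>j\<close> the diagonal factor vanishes outside block row \<open>j\<close>, so
  a single group of terms survives.\<close>

lemma block_of_mult_diag:
  assumes sq: "square_blocks t Bs"
    and X: "X \<in> carrier_mat (block_offset s m) (block_offset t (length Bs))"
    and i: "i < m" and j: "j < length Bs"
  shows "block_of s t (X * diag_block_mat Bs) i j = block_of s t X i j * Bs ! j"
proof (rule eq_matI)
  let ?D = "diag_block_mat Bs"
  have D: "?D \<in> carrier_mat (block_offset t (length Bs)) (block_offset t (length Bs))"
    by (rule diag_block_mat_carrier[OF sq])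
  have B: "Bs ! j \<in> carrier_mat (t j) (t j)" using sq j by (rule square_blocks.nth_carrier)
  show "dim_row (block_of s t (X * ?D) i j) = dim_row (block_of s t X i j * Bs ! j)"
    "dim_col (block_of s t (X * ?D) i j) = dim_col (block_of s t X i j * Bs ! j)"
    using B by (simp_all add: block_of_def)
  fix p q assume "p < dim_row (block_of s t X i j * Bs ! j)" "q < dim_col (block_of s t X i j * Bs ! j)"
  with B have p: "p < s i" and q: "q < t j" by (auto simp: block_of_def)
  define u v where "u = block_offset s i + p" and "v = block_offset t j + q"
  have u: "u < dim_row X" and v: "v < dim_col ?D" and dims: "dim_col X = dim_row ?D"
      "dim_row ?D = block_offset t (length Bs)"
    using X D block_offset_less[of i m p s] block_offset_less[of j "length Bs" q t] i j p q
    unfolding u_def v_def by simp_all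
  have "block_of s t (X * ?D) i j $$ (p, q) = (X * ?D) $$ (u, v)"
    using p q by (simp add: block_of_def u_def v_def)
  also have "\<dots> = (\<Sum>w<block_offset t (length Bs). X $$ (u, w) * ?D $$ (w, v))"
    unfolding index_mult_mat(1)[OF u v] scalar_prod_def dim_col dims(2) atLeast0LessThan
    using u v dims by (intro sum.cong) simp_all
  also have "\<dots> = (\<Sum>l<length Bs. \<Sum>w<t l.
      X $$ (u, block_offset t l + w) * ?D $$ (block_offset t l + w, v))"
    by (rule sum_lessThan_block_offset)
  also have "\<dots> = (\<Sum>l<length Bs. if l = j then
      (\<Sum>w<t l. X $$ (u, block_offset t l + w) * (Bs ! l) $$ (w, q)) else 0)"
    unfolding v_def
    by (intro sum.cong refl) (simp add: index_diag_block_mat[OF sq _ j _ q] del: sum.delta)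
  also have "\<dots> = (\<Sum>w<t j. X $$ (u, block_offset t j + w) * (Bs ! j) $$ (w, q))"
    using j by simp
  also have "\<dots> = (block_of s t X i j * Bs ! j) $$ (p, q)"
    using B p q
    by (simp add: block_of_def scalar_prod_def atLeast0LessThan u_def)
  finally show "block_of s t (X * ?D) i j $$ (p, q) = (block_of s t X i j * Bs ! j) $$ (p, q)" .
qed

text \<open>The right factor is handled by \<open>block_of_mult_diag\<close>. The left factor
  reduces to the same lemma by transposition, since the product of \<open>transpose_mat A\<close>
  and \<open>X\<close> is the transpose of \<open>transpose_mat X * A\<close>.\<close>

lemma block_of_congruence:
  assumes A: "square_blocks s As" and B: "square_blocks t Bs"
    and X: "X \<in> carrier_mat (block_offset s (length As)) (block_offset t (length Bs))"
    and i: "i < length As" and j: "j < length Bs"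
  shows "block_of s t (transpose_mat (diag_block_mat As) * X * diag_block_mat Bs) i j =
           transpose_mat (As ! i) * block_of s t X i j * Bs ! j"
proof -
  let ?A = "diag_block_mat As"
  have DA: "?A \<in> carrier_mat (block_offset s (length As)) (block_offset s (length As))"
    by (rule diag_block_mat_carrier[OF A])
  have Ai: "As ! i \<in> carrier_mat (s i) (s i)" using A i by (rule square_blocks.nth_carrier)
  have XT: "transpose_mat X \<in> carrier_mat (block_offset t (length Bs)) (block_offset s (length As))"
    using X by simp
  have "transpose_mat ?A * X = transpose_mat (transpose_mat X * ?A)"
    using transpose_mult[OF XT DA] by simp
  also have "block_of s t \<dots> i j = transpose_mat (block_of t s (transpose_mat X * ?A) j i)"
    using XT DA by (intro block_of_transpose[OF _ j i]) simp
  also have "\<dots> = transpose_mat (block_of t s (transpose_mat X) j i * As ! i)"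
    using block_of_mult_diag[OF A XT j i] by simp
  also have "\<dots> = transpose_mat (As ! i) * block_of s t X i j"
    using transpose_mult[OF block_of_carrier[of t s "transpose_mat X" j i] Ai]
      block_of_transpose[OF X i j] by simp
  finally have left: "block_of s t (transpose_mat ?A * X) i j =
    transpose_mat (As ! i) * block_of s t X i j" .
  have "transpose_mat ?A * X \<in> carrier_mat (block_offset s (length As)) (block_offset t (length Bs))"
    using DA X by auto
  from block_of_mult_diag[OF B this i j] left show ?thesis by simp
qed

text \<open>A matrix is determined by its blocks, and the congruence acts on each block separately.
  This is applied at two levels: to the decomposition into multiples of the irreducibles, and inside
  one pair of multiples.\<close>

lemma diag_congruence_fixed_iff:
  assumes A: "square_blocks s As" and B: "square_blocks t Bs"
    and X: "X \<in> carrier_mat (block_offset s (length As)) (block_offset t (length Bs))"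
  shows "transpose_mat (diag_block_mat As) * X * diag_block_mat Bs = X \<longleftrightarrow>
           (\<forall>i<length As. \<forall>j<length Bs.
              transpose_mat (As ! i) * block_of s t X i j * Bs ! j = block_of s t X i j)"
    (is "?Y = X \<longleftrightarrow> ?R")
proof
  assume "?Y = X"
  then show ?R using block_of_congruence[OF A B X] by metis
next
  assume R: ?R
  have "?Y \<in> carrier_mat (block_offset s (length As)) (block_offset t (length Bs))"
    using diag_block_mat_carrier[OF A] diag_block_mat_carrier[OF B] X by auto
  then show "?Y = X"
    using X by (rule block_of_eqI) (simp only: block_of_congruence[OF A B X] R[rule_format])
qed

subsection \<open>Invariant pairings of matrix representations\<close>

text \<open>These are the Gram matrices of bilinear pairings between the spaces of \<open>R\<close>
  and \<open>S\<close> that are invariant under both actions; equivalently, for representations of a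
  group, the homomorphisms from \<open>S\<close> to the dual of \<open>R\<close>.\<close>

definition invariant_pairings ::
    "('g, 'c) monoid_scheme \<Rightarrow> nat \<Rightarrow> ('g \<Rightarrow> 'f::field mat) \<Rightarrow> nat \<Rightarrow> ('g \<Rightarrow> 'f mat) \<Rightarrow> 'f mat set" where
  "invariant_pairings G d R e S =
     {Y \<in> carrier_mat d e. \<forall>g\<in>carrier G. transpose_mat (R g) * Y * S g = Y}"

lemma invariant_pairings_carrier: "Y \<in> invariant_pairings G d R e S \<Longrightarrow> Y \<in> carrier_mat d e"
  by (simp add: invariant_pairings_def)

lemma invariant_pairings_add:
  assumes "\<And>g. g \<in> carrier G \<Longrightarrow> R g \<in> carrier_mat d d" "\<And>g. g \<in> carrier G \<Longrightarrow> S g \<in> carrier_mat e e"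
    and X: "X \<in> invariant_pairings G d R e S" and Y: "Y \<in> invariant_pairings G d R e S"
  shows "X + Y \<in> invariant_pairings G d R e S"
proof -
  have "transpose_mat (R g) * (X + Y) * S g = X + Y" if g: "g \<in> carrier G" for g
  proof -
    have R: "transpose_mat (R g) \<in> carrier_mat d d" and S: "S g \<in> carrier_mat e e"
      and X': "X \<in> carrier_mat d e" and Y': "Y \<in> carrier_mat d e"
      using assms g by (auto simp: invariant_pairings_def)
    have "transpose_mat (R g) * (X + Y) * S g =
        transpose_mat (R g) * X * S g + transpose_mat (R g) * Y * S g"
      using mult_add_distrib_mat[OF R X' Y']
        add_mult_distrib_mat[OF mult_carrier_mat[OF R X'] mult_carrier_mat[OF R Y'] S] by simp
    then show ?thesis using X Y g by (simp add: invariant_pairings_def)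
  qed
  then show ?thesis using X Y by (simp add: invariant_pairings_def)
qed

lemma invariant_pairings_smult:
  assumes "\<And>g. g \<in> carrier G \<Longrightarrow> R g \<in> carrier_mat d d" "\<And>g. g \<in> carrier G \<Longrightarrow> S g \<in> carrier_mat e e"
    and X: "X \<in> invariant_pairings G d R e S"
  shows "c \<cdot>\<^sub>m X \<in> invariant_pairings G d R e S"
proof -
  have "transpose_mat (R g) * (c \<cdot>\<^sub>m X) * S g = c \<cdot>\<^sub>m X" if g: "g \<in> carrier G" for g
  proof -
    have R: "transpose_mat (R g) \<in> carrier_mat d d" and S: "S g \<in> carrier_mat e e"
      and X': "X \<in> carrier_mat d e"
      using assms g by (auto simp: invariant_pairings_def)
    have "transpose_mat (R g) * (c \<cdot>\<^sub>m X) * S g = c \<cdot>\<^sub>m (transpose_mat (R g) * X * S g)"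
      using mult_smult_distrib[OF R X'] mult_smult_assoc_mat[OF mult_carrier_mat[OF R X'] S] by simp
    then show ?thesis using X g by (simp add: invariant_pairings_def)
  qed
  then show ?thesis using X by (simp add: invariant_pairings_def)
qed

lemma invariant_pairings_zero:
  assumes "\<And>g. g \<in> carrier G \<Longrightarrow> R g \<in> carrier_mat d d" "\<And>g. g \<in> carrier G \<Longrightarrow> S g \<in> carrier_mat e e"
  shows "0\<^sub>m d e \<in> invariant_pairings G d R e S"
proof -
  have "transpose_mat (R g) * 0\<^sub>m d e * S g = 0\<^sub>m d e" if "g \<in> carrier G" for g
  proof -
    have "transpose_mat (R g) \<in> carrier_mat d d" "S g \<in> carrier_mat e e" using assms that by simp_all
    then show ?thesis by (metis left_mult_zero_mat right_mult_zero_mat)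
  qed
  then show ?thesis by (simp add: invariant_pairings_def)
qed

text \<open>Transposition exchanges the two arguments of the pairing. It transfers statements about
  the kernel on the side of \<open>S\<close> to the side of \<open>R\<close>.\<close>

lemma invariant_pairings_transpose:
  assumes "\<And>g. g \<in> carrier G \<Longrightarrow> R g \<in> carrier_mat d d" "\<And>g. g \<in> carrier G \<Longrightarrow> S g \<in> carrier_mat e e"
    and Y: "Y \<in> invariant_pairings G d R e S"
  shows "transpose_mat Y \<in> invariant_pairings G e S d R"
proof -
  have "transpose_mat (S g) * transpose_mat Y * R g = transpose_mat Y" if g: "g \<in> carrier G" for g
  proof -
    have R: "R g \<in> carrier_mat d d" and S: "S g \<in> carrier_mat e e"
      and Y': "Y \<in> carrier_mat d e"
      using assms g by (auto simp: invariant_pairings_def)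
    have "transpose_mat Y = transpose_mat (transpose_mat (R g) * Y * S g)"
      using Y g by (simp add: invariant_pairings_def)
    also have "\<dots> = transpose_mat (S g) * (transpose_mat Y * R g)"
      using R S Y' transpose_mult[of "transpose_mat (R g) * Y" d e "S g" e]
        transpose_mult[of "transpose_mat (R g)" d d Y e] by simp
    also have "\<dots> = transpose_mat (S g) * transpose_mat Y * R g"
      using R S Y' by (intro assoc_mult_mat[symmetric, of _ e e _ d _ d]) auto
    finally show ?thesis ..
  qed
  then show ?thesis using Y by (simp add: invariant_pairings_def)
qed

section \<open>Matrix representations and the dual representation\<close>

lemma matrix_rep_carrier:
  assumes "matrix_rep G d R" "g \<in> carrier G"
  shows "R g \<in> carrier_mat d d"
  using assms by (auto simp: matrix_rep_def hom_def units_of_def Units_def ring_mat_simps)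

lemma matrix_rep_mult:
  assumes "matrix_rep G d R" "g \<in> carrier G" "h \<in> carrier G"
  shows "R (g \<otimes>\<^bsub>G\<^esub> h) = R g * R h"
  using assms by (auto simp: matrix_rep_def hom_def units_of_def ring_mat_simps)

lemma matrix_rep_one:
  fixes R :: "'g \<Rightarrow> 'f::field mat"
  assumes "group G" "matrix_rep G d R"
  shows "R \<one>\<^bsub>G\<^esub> = 1\<^sub>m d"
proof -
  interpret ring "ring_mat TYPE('f) d ()" by (rule ring_mat)
  have "group_hom G (units_of (ring_mat TYPE('f) d ())) R"
    using assms units_group by (simp add: group_hom_def group_hom_axioms_def matrix_rep_def)
  from group_hom.hom_one[OF this] show ?thesis by (simp add: units_of_def ring_mat_simps)
qed

lemma matrix_rep_inv:
  assumes "group G" "matrix_rep G d R" "g \<in> carrier G"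
  shows "R g * R (inv\<^bsub>G\<^esub> g) = 1\<^sub>m d" "R (inv\<^bsub>G\<^esub> g) * R g = 1\<^sub>m d"
  using assms matrix_rep_mult[of G d R] matrix_rep_one[of G d R] group.inv_closed[OF assms(1,3)]
  by (metis group.r_inv group.l_inv)+

text \<open>The matrix \<open>dual_rep G R g\<close> is the inverse of
  \<open>transpose_mat (R g)\<close>, so it can be moved to the other side of the equation.\<close>

lemma invariant_pairing_iff_intertwines_dual:
  assumes G: "group G" and R: "matrix_rep G d R" and S: "matrix_rep G e S"
    and Y: "Y \<in> carrier_mat d e" and g: "g \<in> carrier G"
  shows "transpose_mat (R g) * Y * S g = Y \<longleftrightarrow> Y * S g = dual_rep G R g * Y"
proof -
  have Rg: "R g \<in> carrier_mat d d" and Ri: "R (inv\<^bsub>G\<^esub> g) \<in> carrier_mat d d"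
    and Sg: "S g \<in> carrier_mat e e"
    by (rule matrix_rep_carrier[OF R g] matrix_rep_carrier[OF R group.inv_closed[OF G g]]
        matrix_rep_carrier[OF S g])+
  have inv: "dual_rep G R g * transpose_mat (R g) = 1\<^sub>m d"
      "transpose_mat (R g) * dual_rep G R g = 1\<^sub>m d"
    using matrix_rep_inv[OF G R g] transpose_mult[OF Rg Ri] transpose_mult[OF Ri Rg]
    unfolding dual_rep_def by (metis transpose_one)+
  have D: "dual_rep G R g \<in> carrier_mat d d" using Ri by (simp add: dual_rep_def)
  have T: "transpose_mat (R g) \<in> carrier_mat d d" using Rg by simp
  have YS: "Y * S g \<in> carrier_mat d e" using Y Sg by simp
  show ?thesis
  proof
    assume "transpose_mat (R g) * Y * S g = Y"
    then have "dual_rep G R g * Y = dual_rep G R g * (transpose_mat (R g) * (Y * S g))"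
      using assoc_mult_mat[OF T Y Sg] by simp
    also have "\<dots> = Y * S g"
      using assoc_mult_mat[OF D T YS] inv left_mult_one_mat[OF YS] by simp
    finally show "Y * S g = dual_rep G R g * Y" ..
  next
    assume "Y * S g = dual_rep G R g * Y"
    then have "transpose_mat (R g) * Y * S g = transpose_mat (R g) * (dual_rep G R g * Y)"
      using assoc_mult_mat[OF T Y Sg] by simp
    also have "\<dots> = Y" using assoc_mult_mat[OF T D Y] inv left_mult_one_mat[OF Y] by simp
    finally show "transpose_mat (R g) * Y * S g = Y" .
  qed
qed

subsection \<open>Schur's lemma\<close>

lemma mat_eq_zeroI:
  fixes Y :: "'f::field mat"
  assumes Y: "Y \<in> carrier_mat d e" and "\<And>v. v \<in> carrier_vec e \<Longrightarrow> Y *\<^sub>v v = 0\<^sub>v d"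
  shows "Y = 0\<^sub>m d e"
proof (rule eq_matI)
  fix p q assume "p < dim_row (0\<^sub>m d e :: 'f mat)" "q < dim_col (0\<^sub>m d e :: 'f mat)"
  then have p: "p < d" and q: "q < e" by simp_all
  have "(Y *\<^sub>v unit_vec e q) $ p = 0" using assms(2)[of "unit_vec e q"] p by simp
  then show "Y $$ (p, q) = 0\<^sub>m d e $$ (p, q)" using Y p q by simp
qed (use Y in auto)

text \<open>The kernel of \<open>Y\<close> is stable under \<open>S\<close>, because
  \<open>Y\<close> intertwines \<open>S\<close> with the dual of \<open>R\<close>. Irreducibility of
  \<open>S\<close> makes the kernel zero or everything, and \<open>Y\<close> is not the zero
  matrix.\<close>

lemma invariant_pairing_injective:
  fixes R S :: "'g \<Rightarrow> 'f::field mat"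
  assumes G: "group G" and R: "matrix_rep G d R" and S: "irreducible_rep G e S"
    and Y: "Y \<in> invariant_pairings G d R e S" "Y \<noteq> 0\<^sub>m d e"
    and v: "v \<in> carrier_vec e" "Y *\<^sub>v v = 0\<^sub>v d"
  shows "v = 0\<^sub>v e"
proof -
  let ?U = "{u \<in> carrier_vec e. Y *\<^sub>v u = 0\<^sub>v d}"
  have Yc: "Y \<in> carrier_mat d e" using Y(1) by (rule invariant_pairings_carrier)
  have S': "matrix_rep G e S" using S by (simp add: irreducible_rep_def)
  have "submodule class_ring ?U (module_vec TYPE('f) e)"
  proof (rule submodule.intro[OF vec_module], unfold module_vec_simps class_ring_simps)
    show "?U \<subseteq> carrier_vec e" by auto
    show "0\<^sub>v e \<in> ?U" using Yc by auto
    show "u + w \<in> ?U" if "u \<in> ?U" "w \<in> ?U" for u w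
      using that Yc by (auto simp: mult_add_distrib_mat_vec)
    show "c \<cdot>\<^sub>v u \<in> ?U" if "u \<in> ?U" for c u
      using that Yc by (auto simp: mult_mat_vec)
  qed
  then have "VectorSpace.subspace class_ring ?U (module_vec TYPE('f) e)"
    by (simp add: VectorSpace.subspace_def vec_vs)
  moreover have "S g *\<^sub>v u \<in> ?U" if g: "g \<in> carrier G" and u: "u \<in> ?U" for g u
  proof -
    have Sg: "S g \<in> carrier_mat e e" using S' g by (rule matrix_rep_carrier)
    have D: "dual_rep G R g \<in> carrier_mat d d"
      using matrix_rep_carrier[OF R group.inv_closed[OF G g]] by (simp add: dual_rep_def)
    have "Y *\<^sub>v (S g *\<^sub>v u) = (Y * S g) *\<^sub>v u"
      using Yc Sg u by (intro assoc_mult_mat_vec[symmetric]) auto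
    also have "Y * S g = dual_rep G R g * Y"
      using invariant_pairing_iff_intertwines_dual[OF G R S' Yc g] Y(1) g
      by (simp add: invariant_pairings_def)
    also have "(dual_rep G R g * Y) *\<^sub>v u = dual_rep G R g *\<^sub>v (Y *\<^sub>v u)"
      using Yc D u by (intro assoc_mult_mat_vec) auto
    also have "\<dots> = 0\<^sub>v d" using u D by auto
    finally show ?thesis using Sg u by auto
  qed
  ultimately have "?U = {0\<^sub>v e} \<or> ?U = carrier_vec e"
    using S unfolding irreducible_rep_def by blast
  moreover have "?U \<noteq> carrier_vec e" using mat_eq_zeroI[OF Yc] Y(2) by blast
  ultimately show ?thesis using v by blast
qed

lemma injective_mat_dim_le:
  fixes Y :: "'f::field mat"
  assumes Y: "Y \<in> carrier_mat d e"
    and inj: "\<And>v. v \<in> carrier_vec e \<Longrightarrow> Y *\<^sub>v v = 0\<^sub>v d \<Longrightarrow> v = 0\<^sub>v e"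
  shows "e \<le> d"
proof (rule ccontr)
  assume "\<not> e \<le> d"
  then have lt: "d < e" by simp
  \<comment> \<open>Pad \<open>Y\<close> with zero rows to a singular square matrix.\<close>
  define Z where "Z = mat e e (\<lambda>(p, q). if p < d then Y $$ (p, q) else 0)"
  have Z: "Z \<in> carrier_mat e e" by (simp add: Z_def)
  \<comment> \<open>Counting from 0, row \<open>d\<close> is the first padded row of
    \<open>Z\<close>; it is zero, so the unit vector at \<open>d\<close> lies in the kernel of the
    transpose.\<close>
  have "transpose_mat Z *\<^sub>v unit_vec e d = 0\<^sub>v e"
    using lt by (intro eq_vecI) (auto simp: Z_def)
  moreover have "unit_vec e d \<noteq> (0\<^sub>v e :: 'f vec)"
    using lt by (metis index_unit_vec(1) index_zero_vec(1) zero_neq_one)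
  ultimately have "det (transpose_mat Z) = 0"
    using Z by (subst det_0_iff_vec_prod_zero[of _ e]) (auto intro: exI[of _ "unit_vec e d"])
  then have "det Z = 0" using det_transpose[OF Z] by simp
  then obtain v where v: "v \<in> carrier_vec e" "v \<noteq> 0\<^sub>v e" and Zv: "Z *\<^sub>v v = 0\<^sub>v e"
    using det_0_iff_vec_prod_zero[OF Z] by auto
  have "Y *\<^sub>v v = 0\<^sub>v d"
  proof (rule eq_vecI)
    fix p assume "p < dim_vec (0\<^sub>v d :: 'f vec)"
    then have p: "p < d" by simp
    have "row Y p = row Z p" using p lt Y by (intro eq_vecI) (auto simp: Z_def)
    then have "(Y *\<^sub>v v) $ p = (Z *\<^sub>v v) $ p" using p lt Y Z by simp
    then show "(Y *\<^sub>v v) $ p = 0\<^sub>v d $ p" using Zv p lt by simp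
  qed (use Y in auto)
  with inj v show False by blast
qed

text \<open>Injectivity of \<open>Y\<close> gives \<open>e \<le> d\<close>, and injectivity of its
  transpose gives \<open>d \<le> e\<close>. A square matrix with trivial kernel has nonzero
  determinant.\<close>

lemma invariant_pairing_invertible:
  assumes G: "group G" and R: "irreducible_rep G d R" and S: "irreducible_rep G e S"
    and Y: "Y \<in> invariant_pairings G d R e S" "Y \<noteq> 0\<^sub>m d e"
  obtains Q where "d = e" "Q \<in> carrier_mat e d" "Y * Q = 1\<^sub>m d" "Q * Y = 1\<^sub>m e"
proof -
  have R': "matrix_rep G d R" and S': "matrix_rep G e S"
    using R S by (simp_all add: irreducible_rep_def)
  have Yc: "Y \<in> carrier_mat d e" using Y(1) by (rule invariant_pairings_carrier)
  have inj: "v = 0\<^sub>v e" if "v \<in> carrier_vec e" "Y *\<^sub>v v = 0\<^sub>v d" for v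
    using invariant_pairing_injective[OF G R' S Y] that .
  have YT: "transpose_mat Y \<in> invariant_pairings G e S d R"
    by (rule invariant_pairings_transpose[OF matrix_rep_carrier[OF R'] matrix_rep_carrier[OF S'] Y(1)])
  have YT0: "transpose_mat Y \<noteq> 0\<^sub>m e d"
    using Y(2) by (metis transpose_transpose zero_transpose_mat)
  have "d \<le> e"
    using injective_mat_dim_le[of "transpose_mat Y" e d] Yc invariant_pairing_injective[OF G S' R YT YT0]
    by simp
  moreover have "e \<le> d" using injective_mat_dim_le[OF Yc] inj by blast
  ultimately have de: "d = e" by simp
  with Yc have Yd: "Y \<in> carrier_mat d d" by simp
  have "det Y \<noteq> 0" using det_0_iff_vec_prod_zero[OF Yd] inj de by blast
  from det_non_zero_imp_unit[OF Yd this, of "()"] obtain Q where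
    "Q \<in> carrier_mat d d" "Y * Q = 1\<^sub>m d" "Q * Y = 1\<^sub>m d"
    by (auto simp: Units_def ring_mat_simps)
  with de that show ?thesis by blast
qed

text \<open>A nonzero pairing is invertible, hence an isomorphism from \<open>S\<close> onto the
  dual of \<open>R\<close>; conversely, the matrix of such an isomorphism is itself an invariant
  pairing.\<close>

lemma ex_invariant_pairing_iff_dual:
  fixes R S :: "'g \<Rightarrow> 'f::field mat"
  assumes G: "group G" and R: "irreducible_rep G d R" and S: "irreducible_rep G e S"
  shows "(\<exists>Y \<in> invariant_pairings G d R e S. Y \<noteq> 0\<^sub>m d e) \<longleftrightarrow>
           isomorphic_reps G e S d (dual_rep G R)"
proof
  have R': "matrix_rep G d R" and S': "matrix_rep G e S"
    using R S by (simp_all add: irreducible_rep_def)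
  note iff = invariant_pairing_iff_intertwines_dual[OF G R' S']
  {
    assume "\<exists>Y \<in> invariant_pairings G d R e S. Y \<noteq> 0\<^sub>m d e"
    then obtain Y where Y: "Y \<in> invariant_pairings G d R e S" "Y \<noteq> 0\<^sub>m d e" by blast
    obtain Q where Q: "Q \<in> carrier_mat e d" "Y * Q = 1\<^sub>m d" "Q * Y = 1\<^sub>m e"
      using invariant_pairing_invertible[OF G R S Y] by blast
    have Yc: "Y \<in> carrier_mat d e" using Y(1) by (rule invariant_pairings_carrier)
    have "\<forall>g\<in>carrier G. Y * S g = dual_rep G R g * Y"
      using iff[OF Yc] Y(1) by (simp add: invariant_pairings_def)
    then show "isomorphic_reps G e S d (dual_rep G R)"
      unfolding isomorphic_reps_def inverts_mat_def using Yc Q by (metis carrier_matD(1))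
  }
  assume "isomorphic_reps G e S d (dual_rep G R)"
  then obtain P Q where P: "P \<in> carrier_mat d e" "Q \<in> carrier_mat e d" "P * Q = 1\<^sub>m d"
    and comm: "\<forall>g\<in>carrier G. P * S g = dual_rep G R g * P"
    unfolding isomorphic_reps_def inverts_mat_def by auto
  have "P \<noteq> 0\<^sub>m d e"
  proof
    assume "P = 0\<^sub>m d e"
    then have "(1\<^sub>m d :: 'f mat) = 0\<^sub>m d d" using P by simp
    \<comment> \<open>The entry at \<open>(0, 0)\<close> exists because an irreducible
      representation has positive degree.\<close>
    then have "(1\<^sub>m d :: 'f mat) $$ (0, 0) = 0\<^sub>m d d $$ (0, 0)" by simp
    then show False using R by (simp add: irreducible_rep_def)
  qed
  then show "\<exists>Y \<in> invariant_pairings G d R e S. Y \<noteq> 0\<^sub>m d e"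
    using P comm iff[OF P(1)] by (intro bexI[of _ P]) (simp_all add: invariant_pairings_def)
qed

text \<open>The characteristic polynomial has positive degree \<open>n\<close>, hence a root in an
  algebraically closed field.\<close>

lemma ex_eigenvalue:
  fixes A :: "'f::alg_closed_field mat"
  assumes A: "A \<in> carrier_mat n n" and "n > 0"
  shows "\<exists>c. eigenvalue A c"
  using alg_closed_imp_poly_has_root[of "char_poly A"] degree_monic_char_poly[OF A] assms(2)
    eigenvalue_root_char_poly[OF A] by auto

text \<open>Second half of Schur's lemma. With \<open>Q\<close> the inverse of \<open>P\<close>,
  choose an eigenvalue \<open>c\<close> of \<open>Q * Y\<close>. The pairing \<open>Y - c P\<close>
  then kills an eigenvector, so it is not injective and must vanish.\<close>

lemma invariant_pairing_scalar:
  fixes R S :: "'g \<Rightarrow> 'f::alg_closed_field mat"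
  assumes G: "group G" and R: "irreducible_rep G d R" and S: "irreducible_rep G e S"
    and P: "P \<in> invariant_pairings G d R e S" "P \<noteq> 0\<^sub>m d e"
    and Y: "Y \<in> invariant_pairings G d R e S"
  shows "\<exists>c. Y = c \<cdot>\<^sub>m P"
proof -
  have R': "matrix_rep G d R" and S': "matrix_rep G e S" and e: "e > 0"
    using R S by (simp_all add: irreducible_rep_def)
  have Pc: "P \<in> carrier_mat d e" and Yc: "Y \<in> carrier_mat d e"
    using P(1) Y by (auto intro: invariant_pairings_carrier)
  obtain Q where Q: "Q \<in> carrier_mat e d" "P * Q = 1\<^sub>m d"
    using invariant_pairing_invertible[OF G R S P] by blast
  have "Q * Y \<in> carrier_mat e e" using Q Yc by simp
  then obtain c v where v: "v \<in> carrier_vec e" "v \<noteq> 0\<^sub>v e" and ev: "(Q * Y) *\<^sub>v v = c \<cdot>\<^sub>v v"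
    using ex_eigenvalue[of "Q * Y" e] e Q by (auto simp: eigenvalue_def eigenvector_def)
  define Z where "Z = Y + (- c) \<cdot>\<^sub>m P"
  have Z: "Z \<in> invariant_pairings G d R e S"
    unfolding Z_def
    by (intro invariant_pairings_add invariant_pairings_smult matrix_rep_carrier[OF R']
        matrix_rep_carrier[OF S'] Y P(1))
  have "Y *\<^sub>v v = (P * Q) *\<^sub>v (Y *\<^sub>v v)" using Q Yc v by simp
  also have "\<dots> = P *\<^sub>v (Q *\<^sub>v (Y *\<^sub>v v))"
    using Pc Q Yc v by (intro assoc_mult_mat_vec) auto
  also have "Q *\<^sub>v (Y *\<^sub>v v) = c \<cdot>\<^sub>v v"
    using assoc_mult_mat_vec[OF Q(1) Yc v(1)] ev by simp
  also have "P *\<^sub>v (c \<cdot>\<^sub>v v) = c \<cdot>\<^sub>v (P *\<^sub>v v)" using Pc v by (simp add: mult_mat_vec)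
  finally have Yv: "Y *\<^sub>v v = c \<cdot>\<^sub>v (P *\<^sub>v v)" .
  have "Z *\<^sub>v v = Y *\<^sub>v v + ((- c) \<cdot>\<^sub>m P) *\<^sub>v v"
    unfolding Z_def using Yc Pc v by (intro add_mult_distrib_mat_vec) auto
  also have "\<dots> = 0\<^sub>v d"
    using Yv Pc v by (intro eq_vecI) auto
  finally have "Z = 0\<^sub>m d e"
    using invariant_pairing_injective[OF G R' S Z _ v(1)] v(2) by blast
  have "Y = c \<cdot>\<^sub>m P"
  proof (rule eq_matI)
    fix p q assume pq: "p < dim_row (c \<cdot>\<^sub>m P)" "q < dim_col (c \<cdot>\<^sub>m P)"
    have "Z $$ (p, q) = 0" using \<open>Z = 0\<^sub>m d e\<close> pq Pc by simp
    then show "Y $$ (p, q) = (c \<cdot>\<^sub>m P) $$ (p, q)" using pq Pc Yc by (simp add: Z_def)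
  qed (use Pc Yc in auto)
  then show ?thesis by blast
qed

subsection \<open>Bilinear forms and their matrices\<close>

lemma bilinear_form_iff:
  fixes scale :: "'f::field \<Rightarrow> 'v::ab_group_add \<Rightarrow> 'v"
  assumes "vector_space scale"
  shows "bilinear_form scale B \<longleftrightarrow>
    (\<forall>x x' y. B (x + x') y = B x y + B x' y) \<and> (\<forall>c x y. B (scale c x) y = c * B x y) \<and>
    (\<forall>x y y'. B x (y + y') = B x y + B x y') \<and> (\<forall>c x y. B x (scale c y) = c * B x y)"
proof -
  have "vector_space ((*) :: 'f \<Rightarrow> 'f \<Rightarrow> 'f)" by unfold_locales (simp_all add: algebra_simps)
  with assms show ?thesis
    unfolding bilinear_form_def Vector_Spaces.linear_iff by auto
qed

locale based_space = vector_space scale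
  for scale :: "'f::field \<Rightarrow> 'v::ab_group_add \<Rightarrow> 'v" +
  fixes n :: nat and b :: "nat \<Rightarrow> 'v"
  assumes basis: "ordered_basis scale n b"
begin

abbreviation coord :: "'v \<Rightarrow> nat \<Rightarrow> 'f" where
  "coord x p \<equiv> representation (b ` {..<n}) x (b p)"

lemma basis_independent: "independent (b ` {..<n})"
  and basis_span: "span (b ` {..<n}) = UNIV"
  and basis_inj: "inj_on b {..<n}"
  using basis by (simp_all add: ordered_basis_def)

lemma sum_coord: "(\<Sum>p<n. scale (coord x p) (b p)) = x"
proof -
  have "(\<Sum>v\<in>b ` {..<n}. scale (representation (b ` {..<n}) x v) v) = x"
    by (rule sum_representation_eq) (auto simp: basis_independent basis_span)
  then show ?thesis by (simp add: sum.reindex[OF basis_inj])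
qed

lemma coord_basis: "p < n \<Longrightarrow> q < n \<Longrightarrow> coord (b p) q = (if q = p then 1 else 0)"
  using representation_basis[OF basis_independent, of "b p"] inj_onD[OF basis_inj, of q p] by auto

lemma coord_add: "coord (x + y) p = coord x p + coord y p"
  and coord_scale: "coord (scale c x) p = c * coord x p"
  by (simp_all add: representation_add representation_scale basis_independent basis_span)

lemma bilinear_form_expand:
  assumes "bilinear_form scale B"
  shows "B x y = (\<Sum>p<n. \<Sum>q<n. coord x p * coord y q * B (b p) (b q))"
proof -
  have left: "module_hom scale (*) (\<lambda>x. B x y)" and right: "module_hom scale (*) (\<lambda>y. B x y)" for x y
    using assms by (simp_all add: bilinear_form_def linear_iff_module_hom)
  have "B x y = B (\<Sum>p<n. scale (coord x p) (b p)) (\<Sum>q<n. scale (coord y q) (b q))"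
    by (simp add: sum_coord)
  also have "\<dots> = (\<Sum>p<n. coord x p * B (b p) (\<Sum>q<n. scale (coord y q) (b q)))"
    unfolding module_hom.sum[OF left] module_hom.scale[OF left] ..
  also have "\<dots> = (\<Sum>p<n. coord x p * (\<Sum>q<n. coord y q * B (b p) (b q)))"
    unfolding module_hom.sum[OF right] module_hom.scale[OF right] ..
  also have "\<dots> = (\<Sum>p<n. \<Sum>q<n. coord x p * coord y q * B (b p) (b q))"
    by (simp add: sum_distrib_left mult.assoc)
  finally show ?thesis .
qed

lemma matrix_of_form_inject:
  assumes "bilinear_form scale B" "bilinear_form scale B'"
    and eq: "matrix_of_form n b B = matrix_of_form n b B'"
  shows "B = B'"
proof (intro ext)
  fix x y
  have "B (b p) (b q) = B' (b p) (b q)" if "p < n" "q < n" for p q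
    using arg_cong[OF eq, of "\<lambda>X. X $$ (p, q)"] that by (simp add: matrix_of_form_def)
  then show "B x y = B' x y"
    unfolding bilinear_form_expand[OF assms(1), of x y] bilinear_form_expand[OF assms(2), of x y]
    by simp
qed

lemma ex_form_of_matrix:
  assumes X: "X \<in> carrier_mat n n"
  shows "\<exists>B. bilinear_form scale B \<and> matrix_of_form n b B = X"
proof (intro exI conjI)
  let ?B = "\<lambda>x y. \<Sum>p<n. \<Sum>q<n. coord x p * coord y q * X $$ (p, q)"
  show "bilinear_form scale ?B"
    unfolding bilinear_form_iff[OF vector_space_axioms] coord_add coord_scale
    by (auto simp: algebra_simps sum.distrib sum_distrib_left)
  show "matrix_of_form n b ?B = X"
  proof (rule eq_matI)
    fix p q assume "p < dim_row X" "q < dim_col X"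
    with X have pq: "p < n" "q < n" by auto
    have "?B (b p) (b q) = (\<Sum>u<n. \<Sum>v<n. if v = q then coord (b p) u * X $$ (u, v) else 0)"
      by (intro sum.cong refl) (use pq in \<open>simp add: coord_basis\<close>)
    also have "\<dots> = (\<Sum>u<n. if u = p then X $$ (u, q) else 0)"
      using pq by (intro sum.cong refl) (simp add: coord_basis)
    finally have "?B (b p) (b q) = X $$ (p, q)" using pq by simp
    then show "matrix_of_form n b ?B $$ (p, q) = X $$ (p, q)"
      using pq by (simp add: matrix_of_form_def)
  qed (use X in \<open>auto simp: matrix_of_form_def\<close>)
qed

text \<open>Both sides are the expansion of \<open>B (f (b p)) (f (b q))\<close> in the basis, since
  the columns of \<open>matrix_of_map scale n b f\<close> are the coordinates of the vectors
  \<open>f (b q)\<close>.\<close>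

lemma matrix_of_pullback:
  assumes B: "bilinear_form scale B"
  shows "matrix_of_form n b (\<lambda>x y. B (f x) (f y)) =
    transpose_mat (matrix_of_map scale n b f) * matrix_of_form n b B * matrix_of_map scale n b f"
    (is "?L = transpose_mat ?C * ?M * ?C")
proof (rule eq_matI)
  have C: "?C \<in> carrier_mat n n" and M: "?M \<in> carrier_mat n n"
    by (simp_all add: matrix_of_map_def matrix_of_form_def)
  show "dim_row ?L = dim_row (transpose_mat ?C * ?M * ?C)"
    "dim_col ?L = dim_col (transpose_mat ?C * ?M * ?C)"
    using C by (simp_all add: matrix_of_form_def)
  fix p q assume "p < dim_row (transpose_mat ?C * ?M * ?C)" "q < dim_col (transpose_mat ?C * ?M * ?C)"
  with C have p: "p < n" and q: "q < n" by simp_all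
  have "(transpose_mat ?C * ?M * ?C) $$ (p, q) =
      (\<Sum>v<n. (\<Sum>u<n. coord (f (b p)) u * B (b u) (b v)) * coord (f (b q)) v)"
    using p q by (simp add: scalar_prod_def matrix_of_map_def matrix_of_form_def atLeast0LessThan)
  also have "\<dots> = (\<Sum>v<n. \<Sum>u<n. coord (f (b p)) u * coord (f (b q)) v * B (b u) (b v))"
    unfolding sum_distrib_right by (intro sum.cong refl) (simp add: mult_ac)
  also have "\<dots> = B (f (b p)) (f (b q))"
    unfolding bilinear_form_expand[OF B, of "f (b p)"] by (rule sum.swap)
  finally show "?L $$ (p, q) = (transpose_mat ?C * ?M * ?C) $$ (p, q)"
    using p q by (simp add: matrix_of_form_def)
qed

text \<open>Invariance under \<open>g\<close> says that \<open>B\<close> equals its pullback along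
  \<open>\<rho> g\<close>. Both are bilinear, so this equality can be tested on their matrices,
  where it becomes the defining equation of the invariant matrices.\<close>

lemma bij_betw_matrix_of_form:
  assumes lin: "\<And>g. g \<in> carrier G \<Longrightarrow> Vector_Spaces.linear scale scale (\<rho> g)"
  shows "bij_betw (matrix_of_form n b) (invariant_forms G scale \<rho>)
    (invariant_matrices G n (\<lambda>g. matrix_of_map scale n b (\<rho> g)))"
proof -
  let ?C = "\<lambda>g. matrix_of_map scale n b (\<rho> g)"
  have inv_iff: "B \<in> invariant_forms G scale \<rho> \<longleftrightarrow> matrix_of_form n b B \<in> invariant_matrices G n ?C"
    if B: "bilinear_form scale B" for B
  proof -
    have "(\<forall>x y. B (\<rho> g x) (\<rho> g y) = B x y) \<longleftrightarrow>
      transpose_mat (?C g) * matrix_of_form n b B * ?C g = matrix_of_form n b B"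
      if g: "g \<in> carrier G" for g
    proof -
      have "bilinear_form scale (\<lambda>x y. B (\<rho> g x) (\<rho> g y))"
        using B lin[OF g] by (simp add: bilinear_form_iff[OF vector_space_axioms] Vector_Spaces.linear_iff)
      then have "(\<lambda>x y. B (\<rho> g x) (\<rho> g y)) = B \<longleftrightarrow>
          matrix_of_form n b (\<lambda>x y. B (\<rho> g x) (\<rho> g y)) = matrix_of_form n b B"
        using matrix_of_form_inject[OF _ B] by metis
      then show ?thesis
        unfolding matrix_of_pullback[OF B, of "\<rho> g"] by (simp add: fun_eq_iff)
    qed
    then show ?thesis
      using B by (simp add: invariant_forms_def invariant_matrices_def matrix_of_form_def)
  qed
  show ?thesis
    unfolding bij_betw_def
  proof
    show "inj_on (matrix_of_form n b) (invariant_forms G scale \<rho>)"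
      using matrix_of_form_inject by (auto simp: inj_on_def invariant_forms_def)
    show "matrix_of_form n b ` invariant_forms G scale \<rho> = invariant_matrices G n ?C"
    proof
      show "matrix_of_form n b ` invariant_forms G scale \<rho> \<subseteq> invariant_matrices G n ?C"
        using inv_iff by (auto simp: invariant_forms_def)
      show "invariant_matrices G n ?C \<subseteq> matrix_of_form n b ` invariant_forms G scale \<rho>"
      proof
        fix X assume X: "X \<in> invariant_matrices G n ?C"
        then have "X \<in> carrier_mat n n" by (simp add: invariant_matrices_def)
        then obtain B where B: "bilinear_form scale B" "matrix_of_form n b B = X"
          using ex_form_of_matrix by blast
        with X inv_iff show "X \<in> matrix_of_form n b ` invariant_forms G scale \<rho>" by blast
      qed
    qed
  qed
qed

lemma vectorspace_form_space:
  "vectorspace class_ring (form_space (invariant_forms G scale \<rho>))"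
proof -
  let ?S = "invariant_forms G scale \<rho>"
  have neg: "\<exists>A\<in>?S. (\<lambda>x y. B x y + A x y) = (\<lambda>x y. 0)" if "B \<in> ?S" for B
    using that
    by (intro bexI[of _ "\<lambda>x y. - B x y"])
      (auto simp: invariant_forms_def bilinear_form_iff[OF vector_space_axioms])
  show ?thesis
    by (rule vs_criteria[OF class_field]; (unfold form_space_def class_ring_simps)?)
      (use neg in \<open>auto simp: invariant_forms_def bilinear_form_iff[OF vector_space_axioms]
        algebra_simps\<close>)
qed

end

subsection \<open>Finite-dimensional spaces of matrices\<close>

lemma invariant_matrices_eq_pairings: "invariant_matrices G n C = invariant_pairings G n C n C"
  by (simp add: invariant_matrices_def invariant_pairings_def)

lemma subspace_matI:
  fixes W :: "'f::field mat set"
  assumes "W \<subseteq> carrier_mat nr nc" "0\<^sub>m nr nc \<in> W"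
    and "\<And>X Y. X \<in> W \<Longrightarrow> Y \<in> W \<Longrightarrow> X + Y \<in> W" "\<And>c X. X \<in> W \<Longrightarrow> c \<cdot>\<^sub>m X \<in> W"
  shows "VectorSpace.subspace class_ring W (module_mat TYPE('f) nr nc)"
proof -
  interpret vectorspace "class_ring :: 'f ring" "module_mat TYPE('f) nr nc" by (rule matrix_vs)
  have "submodule class_ring W (module_mat TYPE('f) nr nc)"
    by (rule submodule.intro[OF module_axioms]) (use assms in \<open>auto simp: module_mat_simps\<close>)
  then show ?thesis by (simp add: VectorSpace.subspace_def vectorspace_axioms)
qed

lemma finsum_mat_carrier:
  fixes x :: "'i \<Rightarrow> 'f::field mat"
  assumes "x \<in> I \<rightarrow> carrier_mat nr nc"
  shows "finsum (module_mat TYPE('f) nr nc) x I \<in> carrier_mat nr nc"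
proof -
  interpret abelian_group "module_mat TYPE('f) nr nc" by (rule abelian_group_mat)
  show ?thesis using finsum_closed[of x I] assms by (simp add: module_mat_simps)
qed

lemma index_finsum_mat:
  fixes x :: "'i \<Rightarrow> 'f::field mat"
  assumes "finite I" "x \<in> I \<rightarrow> carrier_mat nr nc" "p < nr" "q < nc"
  shows "finsum (module_mat TYPE('f) nr nc) x I $$ (p, q) = (\<Sum>i\<in>I. x i $$ (p, q))"
  using assms(1,2)
proof (induction I)
  interpret abelian_group "module_mat TYPE('f) nr nc" by (rule abelian_group_mat)
  {
    case empty
    then show ?case using assms by (simp add: module_mat_simps)
  next
    case (insert i I)
    then have "finsum (module_mat TYPE('f) nr nc) x (insert i I) =
        x i + finsum (module_mat TYPE('f) nr nc) x I"
      using finsum_insert[of I i x] by (simp add: module_mat_simps)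
    moreover have "finsum (module_mat TYPE('f) nr nc) x I \<in> carrier_mat nr nc"
      using insert by (intro finsum_mat_carrier) auto
    ultimately show ?case using insert assms by auto
  }
qed

section \<open>Linear isomorphisms and dimension\<close>

lemma linear_mapI:
  assumes "vectorspace K V" "vectorspace K W" "T \<in> LinearCombinations.module_hom K V W"
  shows "linear_map K V W T"
  using assms by (simp add: linear_map_def mod_hom_def mod_hom_axioms_def vectorspace_def)

lemma linear_map_inv_into:
  assumes "linear_map K V W T" and bij: "bij_betw T (carrier V) (carrier W)"
  shows "linear_map K W V (inv_into (carrier V) T)"
proof -
  interpret linear_map K V W T by fact
  let ?S = "inv_into (carrier V) T"
  have S: "?S w \<in> carrier V" "T (?S w) = w" if "w \<in> carrier W" for w
    using that bij by (metis bij_betw_imp_surj_on inv_into_into, metis bij_betw_inv_into_right)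
  have eqI: "?S w = v" if "v \<in> carrier V" "T v = w" for v w
    using that bij by (auto simp: bij_betw_inv_into_left)
  have "?S (w \<oplus>\<^bsub>W\<^esub> w') = ?S w \<oplus>\<^bsub>V\<^esub> ?S w'" if "w \<in> carrier W" "w' \<in> carrier W" for w w'
    by (rule eqI) (use S that in simp_all)
  moreover have "?S (c \<odot>\<^bsub>W\<^esub> w) = c \<odot>\<^bsub>V\<^esub> ?S w" if "c \<in> carrier K" "w \<in> carrier W" for c w
    by (rule eqI) (use S that in simp_all)
  ultimately have "?S \<in> LinearCombinations.module_hom K W V"
    unfolding LinearCombinations.module_hom_def using S(1) by blast
  then show ?thesis by unfold_locales
qed

text \<open>Dimensions are compared along the inverse of \<open>T\<close>: its domain is the
  coordinate space, which is known to be finite-dimensional, while nothing of the kind is assumed of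
  \<open>V\<close>.\<close>

lemma dim_eq_if_bij_vec:
  fixes V :: "('f::field, 'm, 'e) module_scheme"
  assumes T: "linear_map class_ring V (module_vec TYPE('f) N) T"
    and bij: "bij_betw T (carrier V) (carrier_vec N)"
  shows "vectorspace.dim class_ring V = N"
proof -
  interpret T: linear_map class_ring V "module_vec TYPE('f) N" T by fact
  have bij': "bij_betw T (carrier V) (carrier (module_vec TYPE('f) N))"
    using bij by (simp add: module_vec_simps)
  interpret S: linear_map class_ring "module_vec TYPE('f) N" V "inv_into (carrier V) T"
    by (rule linear_map_inv_into[OF T bij'])
  interpret vec: vec_space "TYPE('f)" N .
  have "bij_betw (inv_into (carrier V) T) (carrier (module_vec TYPE('f) N)) (carrier V)"
    by (rule bij_betw_inv_into[OF bij'])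
  then show ?thesis using S.dim_eq vec.fin_dim vec.dim_is_n by (simp add: bij_betw_def)
qed

subsection \<open>Blocks of invariant matrices\<close>

locale irreducible_family = group G
  for G :: "('g, 'c) monoid_scheme" +
  fixes r :: nat and d k :: "nat \<Rightarrow> nat" and R :: "nat \<Rightarrow> 'g \<Rightarrow> 'f::alg_closed_field mat"
  assumes irreducible: "i < r \<Longrightarrow> irreducible_rep G (d i) (R i)"
begin

abbreviation deg :: "nat \<Rightarrow> nat" where "deg l \<equiv> d l * k l"
text \<open>Here \<open>n\<close> is the total order of the blocks; for an adapted basis it is later
  identified with the degree of the representation.\<close>

abbreviation n :: nat where "n \<equiv> block_offset deg r"

abbreviation pairings :: "nat \<Rightarrow> nat \<Rightarrow> 'f mat set" where
  "pairings i j \<equiv> invariant_pairings G (d i) (R i) (d j) (R j)"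

abbreviation isotypic_pairings :: "nat \<Rightarrow> nat \<Rightarrow> 'f mat set" where
  "isotypic_pairings i j \<equiv>
     invariant_pairings G (deg i) (multiple_rep (k i) (R i)) (deg j) (multiple_rep (k j) (R j))"

abbreviation sub_block :: "nat \<Rightarrow> nat \<Rightarrow> 'f mat \<Rightarrow> nat \<Rightarrow> nat \<Rightarrow> 'f mat" where
  "sub_block i j \<equiv> block_of (\<lambda>_. d i) (\<lambda>_. d j)"

lemma sub_block_carrier [simp]: "sub_block i j Y a c \<in> carrier_mat (d i) (d j)"
  by (simp add: block_of_def)

text \<open>This and the next lemmas are the facts on \<open>block_of\<close> for constant sizes.
  There the offset of \<open>k i\<close> blocks is \<open>k i * d i\<close>, which
  \<open>mult.commute\<close> matches with \<open>deg i\<close>.\<close>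

lemma sub_block_eqI:
  assumes "X \<in> carrier_mat (deg i) (deg j)" "Y \<in> carrier_mat (deg i) (deg j)"
    and "\<And>a c. a < k i \<Longrightarrow> c < k j \<Longrightarrow> sub_block i j X a c = sub_block i j Y a c"
  shows "X = Y"
  using assms block_of_eqI[of X "\<lambda>_. d i" "k i" "\<lambda>_. d j" "k j" Y] by (simp add: mult.commute)

lemma sub_block_add:
  assumes "X \<in> carrier_mat (deg i) (deg j)" "Y \<in> carrier_mat (deg i) (deg j)" "a < k i" "c < k j"
  shows "sub_block i j (X + Y) a c = sub_block i j X a c + sub_block i j Y a c"
  using assms block_of_add[of X "\<lambda>_. d i" "k i" "\<lambda>_. d j" "k j" Y a c] by (simp add: mult.commute)

lemma sub_block_smult:
  assumes "X \<in> carrier_mat (deg i) (deg j)" "a < k i" "c < k j"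
  shows "sub_block i j (z \<cdot>\<^sub>m X) a c = z \<cdot>\<^sub>m sub_block i j X a c"
  using assms block_of_smult[of X "\<lambda>_. d i" "k i" "\<lambda>_. d j" "k j" a c z] by (simp add: mult.commute)

lemma sub_block_zero:
  assumes "a < k i" "c < k j"
  shows "sub_block i j (0\<^sub>m (deg i) (deg j)) a c = 0\<^sub>m (d i) (d j)"
  using assms block_of_zero[of a "k i" c "k j" "\<lambda>_. d i" "\<lambda>_. d j"] by (simp add: mult.commute)

lemma ex_mat_of_sub_blocks:
  assumes "\<And>a c. F a c \<in> carrier_mat (d i) (d j)"
  shows "\<exists>Y \<in> carrier_mat (deg i) (deg j). \<forall>a<k i. \<forall>c<k j. sub_block i j Y a c = F a c"
  using assms ex_mat_of_blocks[of "k i" "k j" F "\<lambda>_. d i" "\<lambda>_. d j"] by (simp add: mult.commute)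

lemma irreducible_carrier: "i < r \<Longrightarrow> g \<in> carrier G \<Longrightarrow> R i g \<in> carrier_mat (d i) (d i)"
  using irreducible[of i] matrix_rep_carrier[of G "d i" "R i" g] by (simp add: irreducible_rep_def)

lemma square_blocks_multiple:
  "i < r \<Longrightarrow> g \<in> carrier G \<Longrightarrow> square_blocks (\<lambda>_. d i) (replicate (k i) (R i g))"
  using irreducible_carrier by unfold_locales simp

lemma multiple_rep_carrier:
  "i < r \<Longrightarrow> g \<in> carrier G \<Longrightarrow> multiple_rep (k i) (R i) g \<in> carrier_mat (deg i) (deg i)"
  using diag_block_mat_carrier[OF square_blocks_multiple[of i g]]
  by (simp add: multiple_rep_def mult.commute)

lemma isotypic_pairings_zero:
  assumes "i < r" "j < r"
  shows "0\<^sub>m (deg i) (deg j) \<in> isotypic_pairings i j"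
  by (rule invariant_pairings_zero) (simp_all add: multiple_rep_carrier assms)

lemma isotypic_pairings_add:
  assumes "i < r" "j < r" "X \<in> isotypic_pairings i j" "Y \<in> isotypic_pairings i j"
  shows "X + Y \<in> isotypic_pairings i j"
  by (rule invariant_pairings_add[OF _ _ assms(3) assms(4)]) (simp_all add: multiple_rep_carrier assms)

lemma isotypic_pairings_smult:
  assumes "i < r" "j < r" "X \<in> isotypic_pairings i j"
  shows "c \<cdot>\<^sub>m X \<in> isotypic_pairings i j"
  by (rule invariant_pairings_smult[OF _ _ assms(3)]) (simp_all add: multiple_rep_carrier assms)

lemma square_blocks_direct_sum:
  "g \<in> carrier G \<Longrightarrow> square_blocks deg (map (\<lambda>i. multiple_rep (k i) (R i) g) [0..<r])"
  using multiple_rep_carrier by unfold_locales simp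

lemma direct_sum_rep_carrier: "g \<in> carrier G \<Longrightarrow> direct_sum_rep r k R g \<in> carrier_mat n n"
  using diag_block_mat_carrier[OF square_blocks_direct_sum[of g]] by (simp add: direct_sum_rep_def)

lemma mat_block_carrier: "mat_block d k X i j \<in> carrier_mat (deg i) (deg j)"
  by (simp add: mat_block_def)

lemma mat_block_eqI:
  assumes "X \<in> carrier_mat n n" "Y \<in> carrier_mat n n"
    and "\<And>i j. i < r \<Longrightarrow> j < r \<Longrightarrow> mat_block d k X i j = mat_block d k Y i j"
  shows "X = Y"
  using assms unfolding mat_block_eq_block_of by (rule block_of_eqI)

lemma mat_block_add:
  assumes "X \<in> carrier_mat n n" "Y \<in> carrier_mat n n" "i < r" "j < r"
  shows "mat_block d k (X + Y) i j = mat_block d k X i j + mat_block d k Y i j"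
  using assms unfolding mat_block_eq_block_of by (rule block_of_add)

lemma mat_block_smult:
  assumes "X \<in> carrier_mat n n" "i < r" "j < r"
  shows "mat_block d k (c \<cdot>\<^sub>m X) i j = c \<cdot>\<^sub>m mat_block d k X i j"
  using assms unfolding mat_block_eq_block_of by (rule block_of_smult)

lemma mat_block_zero:
  assumes "i < r" "j < r"
  shows "mat_block d k (0\<^sub>m n n) i j = 0\<^sub>m (deg i) (deg j)"
  using assms unfolding mat_block_eq_block_of by (rule block_of_zero)

section \<open>Invariance read off from blocks and sub-blocks\<close>

lemma invariant_matrices_iff_blocks:
  assumes X: "X \<in> carrier_mat n n"
  shows "X \<in> invariant_matrices G n (direct_sum_rep r k R) \<longleftrightarrow>
    (\<forall>i<r. \<forall>j<r. mat_block d k X i j \<in> isotypic_pairings i j)"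
proof -
  have "transpose_mat (direct_sum_rep r k R g) * X * direct_sum_rep r k R g = X \<longleftrightarrow>
    (\<forall>i<r. \<forall>j<r. transpose_mat (multiple_rep (k i) (R i) g) * mat_block d k X i j *
       multiple_rep (k j) (R j) g = mat_block d k X i j)" if g: "g \<in> carrier G" for g
    using diag_congruence_fixed_iff[OF square_blocks_direct_sum[OF g] square_blocks_direct_sum[OF g], of X] X
    by (simp add: direct_sum_rep_def mat_block_eq_block_of)
  then show ?thesis
    using X mat_block_carrier by (auto simp: invariant_matrices_def invariant_pairings_def)
qed

lemma isotypic_pairings_iff_sub_blocks:
  assumes i: "i < r" and j: "j < r" and Y: "Y \<in> carrier_mat (deg i) (deg j)"
  shows "Y \<in> isotypic_pairings i j \<longleftrightarrow> (\<forall>a<k i. \<forall>c<k j. sub_block i j Y a c \<in> pairings i j)"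
proof -
  have "transpose_mat (multiple_rep (k i) (R i) g) * Y * multiple_rep (k j) (R j) g = Y \<longleftrightarrow>
    (\<forall>a<k i. \<forall>c<k j. transpose_mat (R i g) * sub_block i j Y a c * R j g = sub_block i j Y a c)"
    if g: "g \<in> carrier G" for g
    using diag_congruence_fixed_iff[OF square_blocks_multiple[OF i g] square_blocks_multiple[OF j g], of Y] Y
    by (simp add: multiple_rep_def mult.commute)
  then show ?thesis using Y by (auto simp: invariant_pairings_def)
qed

text \<open>By Schur's lemma there is no nonzero pairing between \<open>R i\<close> and
  \<open>R j\<close> unless they are dual, so every sub-block vanishes.\<close>

lemma isotypic_pairing_eq_zero:
  assumes i: "i < r" and j: "j < r" and not_dual: "(i, j) \<notin> dual_pairs G r d R"
    and Y: "Y \<in> isotypic_pairings i j"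
  shows "Y = 0\<^sub>m (deg i) (deg j)"
proof -
  have Yc: "Y \<in> carrier_mat (deg i) (deg j)" using Y by (rule invariant_pairings_carrier)
  have "Z = 0\<^sub>m (d i) (d j)" if "Z \<in> pairings i j" for Z
    using ex_invariant_pairing_iff_dual[OF group_axioms irreducible[OF i] irreducible[OF j]] that
      not_dual i j by (auto simp: dual_pairs_def)
  then have "sub_block i j Y a c = 0\<^sub>m (d i) (d j)" if "a < k i" "c < k j" for a c
    using isotypic_pairings_iff_sub_blocks[OF i j Yc] Y that by simp
  then show ?thesis
    by (intro sub_block_eqI[OF Yc zero_carrier_mat]) (simp only: sub_block_zero)
qed

section \<open>The block spaces and their direct sum\<close>

lemma mem_block_space_iff:
  "X \<in> block_space G n r d k R (i, j) \<longleftrightarrow>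
     X \<in> carrier_mat n n \<and> mat_block d k X i j \<in> isotypic_pairings i j \<and>
     (\<forall>i'<r. \<forall>j'<r. (i', j') \<noteq> (i, j) \<longrightarrow> mat_block d k X i' j' = 0\<^sub>m (deg i') (deg j'))"
  by (simp add: block_space_def invariant_pairings_def mat_block_carrier
      eq_commute[of "mat_block d k X i j"])

lemma subspace_block_space:
  assumes i: "i < r" and j: "j < r"
  shows "VectorSpace.subspace class_ring (block_space G n r d k R (i, j)) (module_mat TYPE('f) n n)"
proof -
  let ?W = "block_space G n r d k R (i, j)"
  have "0\<^sub>m n n \<in> ?W"
    by (simp add: mem_block_space_iff mat_block_zero isotypic_pairings_zero i j)
  moreover have "X + Y \<in> ?W" if "X \<in> ?W" "Y \<in> ?W" for X Y
    using that by (simp add: mem_block_space_iff mat_block_add isotypic_pairings_add i j)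
  moreover have "c \<cdot>\<^sub>m X \<in> ?W" if "X \<in> ?W" for c X
    using that by (simp add: mem_block_space_iff mat_block_smult isotypic_pairings_smult i j)
  ultimately show ?thesis
    by (intro subspace_matI) (simp_all add: mem_block_space_iff subset_iff)
qed

text \<open>The summand with index \<open>a\<close> is supported in block \<open>a\<close>, so at
  most one summand contributes to block \<open>(i, j)\<close>.\<close>

lemma mat_block_finsum:
  assumes I: "I \<subseteq> {..<r} \<times> {..<r}" and x: "x \<in> Pi I (block_space G n r d k R)"
    and i: "i < r" and j: "j < r"
  shows "mat_block d k (finsum (module_mat TYPE('f) n n) x I) i j =
    (if (i, j) \<in> I then mat_block d k (x (i, j)) i j else 0\<^sub>m (deg i) (deg j))" (is "?L = ?R")
proof (rule eq_matI)
  have fin: "finite I" using I by (rule finite_subset) simp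
  have xc: "x \<in> I \<rightarrow> carrier_mat n n"
    using x mem_block_space_iff by fastforce
  show "dim_row ?L = dim_row ?R" "dim_col ?L = dim_col ?R" by (simp_all add: mat_block_def)
  fix p q assume "p < dim_row ?R" "q < dim_col ?R"
  then have p: "p < deg i" and q: "q < deg j" by (simp_all add: mat_block_def split: if_splits)
  let ?u = "block_offset deg i + p" and ?v = "block_offset deg j + q"
  have uv: "?u < n" "?v < n" using block_offset_less[of i r p deg] block_offset_less[of j r q deg] i j p q by simp_all
  have "?L $$ (p, q) = (\<Sum>a\<in>I. x a $$ (?u, ?v))"
    using p q index_finsum_mat[OF fin xc uv] by (simp add: mat_block_def)
  also have "\<dots> = (\<Sum>a\<in>I. if a = (i, j) then x a $$ (?u, ?v) else 0)"
  proof (intro sum.cong refl)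
    fix a assume a: "a \<in> I"
    have "mat_block d k (x a) i j $$ (p, q) = 0" if "a \<noteq> (i, j)"
    proof -
      obtain i' j' where [simp]: "a = (i', j')" by (cases a)
      have "x a \<in> block_space G n r d k R (i', j')" using x a by auto
      then show ?thesis using that i j p q by (auto simp: mem_block_space_iff)
    qed
    then show "x a $$ (?u, ?v) = (if a = (i, j) then x a $$ (?u, ?v) else 0)"
      using p q by (simp add: mat_block_def)
  qed
  also have "\<dots> = ?R $$ (p, q)" using fin p q by (simp add: mat_block_def)
  finally show "?L $$ (p, q) = ?R $$ (p, q)" .
qed

lemma ex_mat_with_single_block:
  assumes i: "i < r" and j: "j < r" and Y: "Y \<in> carrier_mat (deg i) (deg j)"
  shows "\<exists>X \<in> carrier_mat n n. mat_block d k X i j = Y \<and>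
    (\<forall>i'<r. \<forall>j'<r. (i', j') \<noteq> (i, j) \<longrightarrow> mat_block d k X i' j' = 0\<^sub>m (deg i') (deg j'))"
proof -
  let ?F = "\<lambda>i' j'. if (i', j') = (i, j) then Y else 0\<^sub>m (deg i') (deg j')"
  have "\<exists>X \<in> carrier_mat n n. \<forall>i'<r. \<forall>j'<r. block_of deg deg X i' j' = ?F i' j'"
    by (rule ex_mat_of_blocks) (use Y in auto)
  then obtain X where "X \<in> carrier_mat n n"
    and "\<And>i' j'. i' < r \<Longrightarrow> j' < r \<Longrightarrow> block_of deg deg X i' j' = ?F i' j'" by blast
  then show ?thesis
    unfolding mat_block_eq_block_of using i j by (intro bexI[of _ X]) auto
qed

lemma internal_direct_sum_block_spaces:
  "internal_direct_sum class_ring (module_mat TYPE('f) n n)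
     (invariant_matrices G n (direct_sum_rep r k R)) (dual_pairs G r d R) (block_space G n r d k R)"
proof -
  let ?A = "dual_pairs G r d R" and ?W = "block_space G n r d k R"
  let ?\<Xi> = "invariant_matrices G n (direct_sum_rep r k R)" and ?M = "module_mat TYPE('f) n n"
  have A: "?A \<subseteq> {..<r} \<times> {..<r}" by (auto simp: dual_pairs_def)
  have fin: "finite ?A" using A by (rule finite_subset) simp
  have W_carrier: "X \<in> carrier_mat n n" if "X \<in> ?W a" for a X
    using that by (cases a) (simp add: mem_block_space_iff)
  have sum_carrier: "finsum ?M x ?A \<in> carrier_mat n n" if "x \<in> Pi ?A ?W" for x
    using that W_carrier by (intro finsum_mat_carrier) auto
  have sub: "\<forall>a\<in>?A. VectorSpace.subspace class_ring (?W a) ?M"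
    using A subspace_block_space by auto
  have sums: "?\<Xi> = {finsum ?M x ?A | x. x \<in> Pi ?A ?W}"
  proof (intro equalityI subsetI)
    fix X assume X: "X \<in> ?\<Xi>"
    then have Xc: "X \<in> carrier_mat n n" by (simp add: invariant_matrices_def)
    have iso: "mat_block d k X i j \<in> isotypic_pairings i j" if "i < r" "j < r" for i j
      using invariant_matrices_iff_blocks[OF Xc] X that by blast
    \<comment> \<open>\<open>Z\<close> is \<open>X\<close> with all blocks except
      \<open>(i, j)\<close> erased. These truncations, taken over the dual pairs, are the components
      of \<open>X\<close>.\<close>
    have "\<exists>Z. Z \<in> ?W (i, j) \<and> mat_block d k Z i j = mat_block d k X i j" if ij: "i < r" "j < r" for i j
    proof -
      obtain Z where "Z \<in> carrier_mat n n" "mat_block d k Z i j = mat_block d k X i j"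
        "\<forall>i'<r. \<forall>j'<r. (i', j') \<noteq> (i, j) \<longrightarrow> mat_block d k Z i' j' = 0\<^sub>m (deg i') (deg j')"
        using ex_mat_with_single_block[OF ij mat_block_carrier[of X i j]] by blast
      then show ?thesis using iso[OF ij] by (auto simp: mem_block_space_iff)
    qed
    then obtain z where z: "\<And>i j. i < r \<Longrightarrow> j < r \<Longrightarrow>
        z i j \<in> ?W (i, j) \<and> mat_block d k (z i j) i j = mat_block d k X i j"
      by metis
    define x where "x = (\<lambda>(i, j). z i j)"
    have x: "x \<in> Pi ?A ?W" using z A by (auto simp: x_def)
    have "X = finsum ?M x ?A"
    proof (rule mat_block_eqI[OF Xc sum_carrier[OF x]])
      fix i j assume ij: "i < r" "j < r"
      \<comment> \<open>Outside the dual pairs the sum has a zero block, and so does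
        \<open>X\<close> by \<open>isotypic_pairing_eq_zero\<close>.\<close>
      show "mat_block d k X i j = mat_block d k (finsum ?M x ?A) i j"
        using mat_block_finsum[OF A x ij] z[OF ij] isotypic_pairing_eq_zero[OF ij _ iso[OF ij]]
        by (simp add: x_def)
    qed
    with x show "X \<in> {finsum ?M x ?A | x. x \<in> Pi ?A ?W}" by blast
  next
    fix X assume "X \<in> {finsum ?M x ?A | x. x \<in> Pi ?A ?W}"
    then obtain x where x: "x \<in> Pi ?A ?W" and X: "X = finsum ?M x ?A" by blast
    have "mat_block d k X i j \<in> isotypic_pairings i j" if ij: "i < r" "j < r" for i j
    proof (cases "(i, j) \<in> ?A")
      case True
      then have "x (i, j) \<in> ?W (i, j)" using x by auto
      then show ?thesis using True mat_block_finsum[OF A x ij] X by (simp add: mem_block_space_iff)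
    next
      case False
      then show ?thesis using mat_block_finsum[OF A x ij] X isotypic_pairings_zero[OF ij] by simp
    qed
    then show "X \<in> ?\<Xi>"
      using invariant_matrices_iff_blocks[of X] sum_carrier[OF x] X by blast
  qed
  \<comment> \<open>Directness: block \<open>a\<close> of a vanishing sum is block \<open>a\<close>
    of \<open>x a\<close> alone, and the other blocks of \<open>x a\<close> are zero by membership
    in the block space.\<close>
  have "\<forall>a\<in>?A. x a = 0\<^sub>m n n" if x: "x \<in> Pi ?A ?W" and 0: "finsum ?M x ?A = 0\<^sub>m n n" for x
  proof
    fix a assume a: "a \<in> ?A"
    then obtain i j where a_eq: "a = (i, j)" and ij: "i < r" "j < r" using A by auto
    have xa: "x a \<in> ?W (i, j)" using x a a_eq by auto
    show "x a = 0\<^sub>m n n"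
    proof (rule mat_block_eqI)
      fix i' j' assume ij': "i' < r" "j' < r"
      show "mat_block d k (x a) i' j' = mat_block d k (0\<^sub>m n n) i' j'"
      proof (cases "(i', j') = (i, j)")
        case True
        then show ?thesis using mat_block_finsum[OF A x ij] 0 a a_eq by simp
      next
        case False
        then show ?thesis using xa ij' by (simp add: mem_block_space_iff mat_block_zero)
      qed
    qed (use xa W_carrier in auto)
  qed
  with fin sub sums show ?thesis
    by (simp add: internal_direct_sum_def module_mat_simps)
qed

section \<open>Dimension of a block space\<close>

text \<open>Fix a nonzero pairing \<open>P\<close> of \<open>R i\<close> and \<open>R j\<close> and
  a position \<open>(p, q)\<close> where it does not vanish. Each of the \<open>k i * k j\<close>
  sub-blocks is a multiple of \<open>P\<close>, so it is determined by its entry at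
  \<open>(p, q)\<close>. Reading off these entries gives a linear bijection onto the coordinate
  space.\<close>

lemma dim_block_space:
  assumes ij: "(i, j) \<in> dual_pairs G r d R"
  shows "vectorspace.dim class_ring
    ((module_mat TYPE('f) n n)\<lparr>carrier := block_space G n r d k R (i, j)\<rparr>) = k i * k j"
proof -
  let ?W = "block_space G n r d k R (i, j)" and ?N = "k i * k j"
  let ?V = "(module_mat TYPE('f) n n)\<lparr>carrier := ?W\<rparr>"
  have i: "i < r" and j: "j < r" using ij by (auto simp: dual_pairs_def)
  obtain P where P: "P \<in> pairings i j" "P \<noteq> 0\<^sub>m (d i) (d j)"
    using ex_invariant_pairing_iff_dual[OF group_axioms irreducible[OF i] irreducible[OF j]] ij
    by (auto simp: dual_pairs_def)
  have Pc: "P \<in> carrier_mat (d i) (d j)" using P(1) by (rule invariant_pairings_carrier)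
  obtain p q where p: "p < d i" and q: "q < d j" and Ppq: "P $$ (p, q) \<noteq> 0"
  proof -
    have "\<not> (\<forall>p<d i. \<forall>q<d j. P $$ (p, q) = 0)"
      using P(2) Pc by (metis (no_types, lifting) eq_matI carrier_matD index_zero_mat)
    then show thesis using that by blast
  qed
  define B where "B X = sub_block i j (mat_block d k X i j)" for X
  \<comment> \<open>The coordinate \<open>t = a * k j + c\<close> belongs to sub-block
    \<open>(a, c)\<close>, in row-major order. If \<open>k i\<close> or \<open>k j\<close> is 0, the
    target is the space of empty vectors.\<close>
  define T where "T X = vec ?N (\<lambda>t. B X (t div k j) (t mod k j) $$ (p, q))" for X
  have W_carrier: "X \<in> carrier_mat n n" if "X \<in> ?W" for X
    using that by (simp add: mem_block_space_iff)
  have B_dim: "dim_row (B X a c) = d i" "dim_col (B X a c) = d j" for X a c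
    by (simp_all add: B_def block_of_def)
  have B_scalar: "\<exists>z. B X a c = z \<cdot>\<^sub>m P" if "X \<in> ?W" "a < k i" "c < k j" for X a c
  proof -
    have "B X a c \<in> pairings i j"
      using that isotypic_pairings_iff_sub_blocks[OF i j mat_block_carrier]
      by (simp add: mem_block_space_iff B_def)
    from invariant_pairing_scalar[OF group_axioms irreducible[OF i] irreducible[OF j] P this]
    show ?thesis .
  qed
  have B_add: "B (X + Y) a c = B X a c + B Y a c"
    if "X \<in> ?W" "Y \<in> ?W" "a < k i" "c < k j" for X Y a c
    using that by (simp add: B_def mat_block_add[OF _ _ i j] sub_block_add W_carrier mat_block_carrier)
  have B_smult: "B (z \<cdot>\<^sub>m X) a c = z \<cdot>\<^sub>m B X a c" if "X \<in> ?W" "a < k i" "c < k j" for X z a c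
    using that by (simp add: B_def mat_block_smult[OF _ i j] sub_block_smult W_carrier mat_block_carrier)
  have div_mod: "t div k j < k i" "t mod k j < k j" if "t < ?N" for t
    using that by (cases "k j = 0"; simp add: less_mult_imp_div_less)+
  have index: "a * k j + c < ?N" "(a * k j + c) div k j = a" "(a * k j + c) mod k j = c"
    if "a < k i" "c < k j" for a c
  proof -
    have "a * k j + c < Suc a * k j" using that by simp
    also have "\<dots> \<le> k i * k j" using that by (intro mult_right_mono) auto
    finally show "a * k j + c < ?N" .
  qed (use that in auto)
  have vs: "vectorspace class_ring ?V"
    using vectorspace.subspace_is_vs[OF matrix_vs subspace_block_space[OF i j]] .
  have lin: "linear_map class_ring ?V (module_vec TYPE('f) ?N) T"
  proof (rule linear_mapI[OF vs vec_vs])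
    have "T (X + Y) = T X + T Y" if "X \<in> ?W" "Y \<in> ?W" for X Y
      using that p q by (intro eq_vecI) (auto simp: T_def B_add B_dim div_mod)
    moreover have "T (z \<cdot>\<^sub>m X) = z \<cdot>\<^sub>v T X" if "X \<in> ?W" for X z
      using that p q by (intro eq_vecI) (auto simp: T_def B_smult B_dim div_mod)
    ultimately show "T \<in> LinearCombinations.module_hom class_ring ?V (module_vec TYPE('f) ?N)"
      by (simp add: LinearCombinations.module_hom_def module_mat_simps module_vec_simps T_def)
  qed
  have "inj_on T ?W"
  proof (rule inj_onI)
    fix X Y assume X: "X \<in> ?W" and Y: "Y \<in> ?W" and eq: "T X = T Y"
    have "B X a c = B Y a c" if ac: "a < k i" "c < k j" for a c
    proof -
      obtain x y where xy: "B X a c = x \<cdot>\<^sub>m P" "B Y a c = y \<cdot>\<^sub>m P"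
        using B_scalar X Y ac by meson
      have "B X a c $$ (p, q) = B Y a c $$ (p, q)"
        using arg_cong[OF eq, of "\<lambda>v. v $ (a * k j + c)"] index[OF ac] by (simp add: T_def)
      \<comment> \<open>Comparing entries at \<open>(p, q)\<close> and cancelling the nonzero entry
        of \<open>P\<close> gives \<open>x = y\<close>.\<close>
      then show ?thesis using xy Pc p q Ppq by simp
    qed
    then have eq_ij: "mat_block d k X i j = mat_block d k Y i j"
      unfolding B_def by (rule sub_block_eqI[OF mat_block_carrier mat_block_carrier])
    show "X = Y"
    proof (rule mat_block_eqI[OF W_carrier[OF X] W_carrier[OF Y]])
      fix i' j' assume "i' < r" "j' < r"
      then show "mat_block d k X i' j' = mat_block d k Y i' j'"
        using X Y eq_ij by (cases "(i', j') = (i, j)") (simp_all add: mem_block_space_iff)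
    qed
  qed
  moreover have "T ` ?W = carrier_vec ?N"
  proof (intro equalityI subsetI)
    fix v :: "'f vec" assume v: "v \<in> carrier_vec ?N"
    \<comment> \<open>Division by the entry of \<open>P\<close> normalises each sub-block so that
      its entry at \<open>(p, q)\<close> is the prescribed coordinate of \<open>v\<close>.\<close>
    let ?F = "\<lambda>a c. (v $ (a * k j + c) / P $$ (p, q)) \<cdot>\<^sub>m P"
    have "\<exists>Y \<in> carrier_mat (deg i) (deg j). \<forall>a<k i. \<forall>c<k j. sub_block i j Y a c = ?F a c"
      by (rule ex_mat_of_sub_blocks) (use Pc in simp)
    then obtain Y where Y: "Y \<in> carrier_mat (deg i) (deg j)"
      and sub: "\<And>a c. a < k i \<Longrightarrow> c < k j \<Longrightarrow> sub_block i j Y a c = ?F a c" by blast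
    have "?F a c \<in> pairings i j" for a c
      by (rule invariant_pairings_smult[OF _ _ P(1)]) (simp_all add: irreducible_carrier i j)
    then have "Y \<in> isotypic_pairings i j"
      using isotypic_pairings_iff_sub_blocks[OF i j Y] sub by simp
    then obtain X where X: "X \<in> ?W" "mat_block d k X i j = Y"
      using ex_mat_with_single_block[OF i j Y] by (auto simp: mem_block_space_iff)
    have "T X = v"
      using v X(2) sub Pc p q Ppq by (intro eq_vecI) (auto simp: T_def B_def div_mod)
    with X show "v \<in> T ` ?W" by blast
  qed (auto simp: T_def)
  ultimately have "bij_betw T (carrier ?V) (carrier_vec ?N)" by (simp add: bij_betw_def)
  with lin show ?thesis by (rule dim_eq_if_bij_vec)
qed

end

section \<open>Assembly: from forms on the abstract space to block spaces\<close>

theorem theorem1p2: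
  fixes G :: "('g, 'c) monoid_scheme"
    and scale :: "'f::alg_closed_field \<Rightarrow> 'v::ab_group_add \<Rightarrow> 'v"
    and n r :: nat
    and \<rho> :: "'g \<Rightarrow> 'v \<Rightarrow> 'v"
    and d k :: "nat \<Rightarrow> nat"
    and R :: "nat \<Rightarrow> 'g \<Rightarrow> 'f mat"
    and b :: "nat \<Rightarrow> 'v"
  assumes "group G" and "Coset.order G = 8"
    and "CHAR('f) \<noteq> 2"
    and "n > 0"
    and "complete_irreps G r d R"
    and "representation_of_degree G scale n \<rho>"
    and "adapted_basis G scale n \<rho> r k R b"
  defines "\<Xi> \<equiv> invariant_forms G scale \<rho>"
    and "\<Xi>' \<equiv> invariant_matrices G n (\<lambda>g. matrix_of_map scale n b (\<rho> g))"
    and "A \<equiv> dual_pairs G r d R"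
    and "W \<equiv> block_space G n r d k R"
    and "M \<equiv> module_mat TYPE('f) n n"
  shows "linear_map class_ring (form_space \<Xi>) (M\<lparr>carrier := \<Xi>'\<rparr>) (matrix_of_form n b) \<and>
         bij_betw (matrix_of_form n b) \<Xi> \<Xi>' \<and>
         internal_direct_sum class_ring M \<Xi>' A W \<and>
         (\<forall>(i, j)\<in>A. vectorspace.dim class_ring (M\<lparr>carrier := W (i, j)\<rparr>) = k i * k j)"
proof -
  interpret irreducible_family G r d k R
    using assms(1,5) by (simp add: irreducible_family_def irreducible_family_axioms_def complete_irreps_def)
  interpret based_space scale n b
    using assms(6,7)
    by (simp add: based_space_def based_space_axioms_def representation_of_degree_def adapted_basis_def)
  let ?C = "\<lambda>g. matrix_of_map scale n b (\<rho> g)"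
  have C: "?C g = direct_sum_rep r k R g" if "g \<in> carrier G" for g
    using assms(7) that by (simp add: adapted_basis_def)
  have C_carrier: "?C g \<in> carrier_mat n n" for g by (simp add: matrix_of_map_def)
  \<comment> \<open>At the identity of \<open>G\<close>, the matrix of the map and the direct sum
    matrix agree; comparing their numbers of rows identifies the degree with the total order of the
    blocks.\<close>
  have n_eq: "n = block_offset (\<lambda>l. d l * k l) r"
    using C_carrier[of "\<one>\<^bsub>G\<^esub>"] direct_sum_rep_carrier[OF one_closed] C[OF one_closed]
    by (metis carrier_matD(1))
  have \<Xi>': "\<Xi>' = invariant_matrices G n (direct_sum_rep r k R)"
    unfolding \<Xi>'_def invariant_matrices_def by (simp add: C)
  have lin: "Vector_Spaces.linear scale scale (\<rho> g)" if "g \<in> carrier G" for g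
    using assms(6) that
    by (auto simp: representation_of_degree_def hom_def GL_space_def)
  have bij: "bij_betw (matrix_of_form n b) \<Xi> \<Xi>'"
    unfolding \<Xi>_def \<Xi>'_def by (rule bij_betw_matrix_of_form[OF lin])
  \<comment> \<open>The invariant matrices are the invariant pairings of the matrix family with
    itself, so the closure properties of pairings apply.\<close>
  have "VectorSpace.subspace class_ring \<Xi>' M"
    unfolding M_def
  proof (rule subspace_matI)
    show "\<Xi>' \<subseteq> carrier_mat n n" by (auto simp: \<Xi>'_def invariant_matrices_def)
  qed (auto simp: \<Xi>'_def invariant_matrices_eq_pairings C_carrier
      intro!: invariant_pairings_zero invariant_pairings_add invariant_pairings_smult)
  then have vs: "vectorspace class_ring (M\<lparr>carrier := \<Xi>'\<rparr>)"
    unfolding M_def by (rule vectorspace.subspace_is_vs[OF matrix_vs])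
  have "linear_map class_ring (form_space \<Xi>) (M\<lparr>carrier := \<Xi>'\<rparr>) (matrix_of_form n b)"
  proof (rule linear_mapI[OF _ vs])
    show "vectorspace class_ring (form_space \<Xi>)"
      unfolding \<Xi>_def by (rule vectorspace_form_space)
    have "matrix_of_form n b B \<in> \<Xi>'" if "B \<in> \<Xi>" for B
      using bij that by (auto simp: bij_betw_def)
    then show "matrix_of_form n b \<in> LinearCombinations.module_hom class_ring (form_space \<Xi>) (M\<lparr>carrier := \<Xi>'\<rparr>)"
      by (auto simp: LinearCombinations.module_hom_def form_space_def M_def module_mat_simps
          matrix_of_form_def intro!: eq_matI)
  qed
  moreover have "internal_direct_sum class_ring M \<Xi>' A W"
    unfolding \<Xi>' M_def A_def W_def n_eq by (rule internal_direct_sum_block_spaces)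
  moreover have "\<forall>(i, j)\<in>A. vectorspace.dim class_ring (M\<lparr>carrier := W (i, j)\<rparr>) = k i * k j"
    unfolding M_def A_def W_def n_eq using dim_block_space by auto
  ultimately show ?thesis using bij by blast
qed

end
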